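(* Let $G(s)=C(sI-A)^{-1}B$ be a stable system, with real matrices $A\in\mathbb R^{n\times n}$, $B\in\mathbb R^{n\times m_w}$, $C\in\mathbb R^{p_z\times n}$. Then $$\mathcal K(G)\;\leq\;\mathcal M_0(G)\;\leq\; e\,n\,\mathcal K(G),$$ where $e$ is Euler's number and $n$ is the size of $A$.
   Context: $\overline{\sigma}(M)$ denotes the maximum singular value of a matrix $M$. Stable means that all eigenvalues of $A$ have negative real part. The Kreiss system norm is $\mathcal K(G):=\sup_{\mathrm{Re}(s)>0}\mathrm{Re}(s)\,\overline{\sigma}(C(sI-A)^{-1}B)$, the supremum being over complex $s$ with $\mathrm{Re}(s)>0$, and the worst case transient peak norm is $\mathcal M_0(G):=\sup_{t\geq 0}\overline{\sigma}(Ce^{At}B)$. *)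

theory Defs
  imports "HOL-Analysis.Analysis"
begin

abbreviation complex_matrix :: "real^'n^'m \<Rightarrow> complex^'n^'m" where
  "complex_matrix \<equiv> map_matrix complex_of_real"

definition conj_transpose :: "complex^'n^'m \<Rightarrow> complex^'m^'n" where
  "conj_transpose M = transpose (map_matrix cnj M)"

definition mat_eigenvalue :: "complex^'n^'n \<Rightarrow> complex \<Rightarrow> bool" where
  "mat_eigenvalue M \<mu> \<longleftrightarrow> (\<exists>v. v \<noteq> 0 \<and> M *v v = \<mu> *s v)"

(* For M with more columns than rows this set contains 0 even if all
   min(rows, columns) singular values in the narrow sense are positive;
   the maximum is the same under both conventions. *)
definition singular_values :: "complex^'n^'m \<Rightarrow> real set" where
  "singular_values M =
     {\<sigma>. 0 \<le> \<sigma> \<and> mat_eigenvalue (conj_transpose M ** M) (complex_of_real (\<sigma>\<^sup>2))}"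

definition max_singular_value :: "complex^'n^'m \<Rightarrow> real" where
  "max_singular_value M = Max (singular_values M)"

(* The library's product, power and unit on the type vec are componentwise;
   matrix powers have to be built from the matrix product and mat 1. *)
primrec mat_power :: "'a::semiring_1^'n^'n \<Rightarrow> nat \<Rightarrow> 'a^'n^'n" where
  "mat_power M 0 = mat 1"
| "mat_power M (Suc k) = M ** mat_power M k"

definition mat_exp :: "real^'n^'n \<Rightarrow> real^'n^'n" where
  "mat_exp M = (\<Sum>k. mat_power M k /\<^sub>R fact k)"

definition stable :: "real^'n^'n \<Rightarrow> bool" where
  "stable A \<longleftrightarrow> (\<forall>\<mu>. mat_eigenvalue (complex_matrix A) \<mu> \<longrightarrow> Re \<mu> < 0)"

definition transfer_function ::
  "real^'n^'n \<Rightarrow> real^'m^'n \<Rightarrow> real^'n^'p \<Rightarrow> complex \<Rightarrow> complex^'m^'p" where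
  "transfer_function A B C s =
     complex_matrix C ** matrix_inv (mat s - complex_matrix A) ** complex_matrix B"

(* The suprema are taken in the extended reals, so they are genuine least upper
   bounds without any boundedness assumption. *)
definition kreiss_norm ::
  "real^'n^'n \<Rightarrow> real^'m^'n \<Rightarrow> real^'n^'p \<Rightarrow> ereal" where
  "kreiss_norm A B C =
     (SUP s\<in>{s. 0 < Re s}. ereal (Re s * max_singular_value (transfer_function A B C s)))"

definition transient_peak_norm ::
  "real^'n^'n \<Rightarrow> real^'m^'n \<Rightarrow> real^'n^'p \<Rightarrow> ereal" where
  "transient_peak_norm A B C =
     (SUP t\<in>{0..}. ereal (max_singular_value (complex_matrix (C ** mat_exp (t *\<^sub>R A) ** B))))"

end

theory Submission
  imports Defs "HOL-Complex_Analysis.Complex_Analysis"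
begin

text \<open>
  For vectors \<open>u\<close>, \<open>v\<close> the function \<open>r(z) = u\<^sup>T (zI - A)\<^bsup>-1\<^esup> v\<close> is rational of degree at most
  \<open>n\<close>. Inverting the Laplace transform on the line \<open>Re z = \<sigma>\<close> and integrating by parts gives
  \<open>|u\<^sup>T e\<^bsup>tA\<^esup> v| \<le> e\<^bsup>\<sigma>t\<^esup> / (2\<pi>t) \<integral> |r'|\<close>, and Spijker's lemma bounds the arc length \<open>\<integral> |r'|\<close> by
  \<open>2\<pi>n sup |r|\<close>; the choice \<open>\<sigma> = 1/t\<close> yields the constant \<open>e n\<close>. Spijker's lemma follows
  Wegert and Trefethen: by Buffon's needle argument the length of an arc is an average of the total
  variations of its projections to lines, and every projection is a real rational function of degree
  at most \<open>2n\<close>, which takes each value at most \<open>2n\<close> times or is constant. The lower bound is the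
  estimate of the Laplace transform by the supremum of \<open>|C e\<^bsup>tA\<^esup> B|\<close>.
\<close>

subsection \<open>Spijker's lemma\<close>

lemma crossing_between:
  fixes g :: "real \<Rightarrow> real"
  assumes "a < b" "continuous_on {a..b} g" "min (g a) (g b) < y" "y < max (g a) (g b)"
  obtains x where "a < x" "x < b" "g x = y"
proof -
  have "\<exists>x\<ge>a. x \<le> b \<and> g x = y"
  proof (cases "g a \<le> g b")
    case True
    then show ?thesis using assms by (intro IVT') auto
  next
    case False
    then show ?thesis using assms by (intro IVT2') auto
  qed
  then obtain x where x: "a \<le> x" "x \<le> b" "g x = y" by blast
  have "x \<noteq> a" "x \<noteq> b" using x(3) assms(3,4) by (auto simp: min_def max_def split: if_splits)
  with x that show thesis by force
qed

text \<open>The number of increments straddling a height is at most the number of crossings of that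
  height; integrating over all heights bounds the total variation (Banach's indicatrix).\<close>

lemma variation_le_crossings:
  fixes g :: "real \<Rightarrow> real" and t :: "nat \<Rightarrow> real"
  assumes t: "strict_mono t"
    and cont: "continuous_on {t 0..t m} g"
    and bound: "\<And>x. x \<in> {t 0..t m} \<Longrightarrow> \<bar>g x\<bar> \<le> M"
    and fin: "\<And>y. finite {x \<in> {t 0..t m}. g x = y}"
    and card: "\<And>y. card {x \<in> {t 0..t m}. g x = y} \<le> N"
  shows "(\<Sum>i<m. \<bar>g (t (Suc i)) - g (t i)\<bar>) \<le> 2 * M * N"
proof -
  \<comment> \<open>Open intervals: a crossing then lies strictly inside its mesh interval, so
    different increments give different crossings of the same height.\<close>
  define I where "I i = {min (g (t i)) (g (t (Suc i))) <..< max (g (t i)) (g (t (Suc i)))}" for i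
  have mem: "t i \<in> {t 0..t m}" if "i \<le> m" for i
    using that t by (simp add: strict_mono_less_eq)
  have M0: "0 \<le> M" using bound[OF mem[of 0]] by simp
  have sub: "{t i..t (Suc i)} \<subseteq> {t 0..t m}" if "i < m" for i
    using that mem[of i] mem[of "Suc i"] by auto
  have count: "(\<Sum>i<m. indicator (I i) y) \<le> (N::real) * indicator {-M..M} y" for y
  proof (cases "y \<in> {-M..M}")
    case False
    have "y \<notin> I i" if "i < m" for i
      using False bound[OF mem[of i]] bound[OF mem[of "Suc i"]] that
      by (auto simp: I_def min_def max_def split: if_splits)
    with False show ?thesis by (simp add: indicator_def)
  next
    case True
    define S where "S = {i. i < m \<and> y \<in> I i}"
    have "\<exists>x. t i < x \<and> x < t (Suc i) \<and> g x = y" if "i \<in> S" for i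
    proof -
      have "t i < t (Suc i)" using t by (simp add: strict_mono_def)
      moreover have "continuous_on {t i..t (Suc i)} g"
        using continuous_on_subset[OF cont sub] that by (simp add: S_def)
      ultimately show ?thesis
        using that crossing_between[of "t i" "t (Suc i)" g y] by (auto simp: S_def I_def)
    qed
    then obtain x where x: "\<And>i. i \<in> S \<Longrightarrow> t i < x i \<and> x i < t (Suc i) \<and> g (x i) = y"
      by metis
    have "x i < x j" if "i \<in> S" "j \<in> S" "i < j" for i j
    proof -
      have "t (Suc i) \<le> t j" using that t by (simp add: strict_mono_less_eq)
      with x[OF that(1)] x[OF that(2)] show ?thesis by linarith
    qed
    then have inj: "inj_on x S"
      by (metis inj_onI less_irrefl linorder_neqE_nat)
    have "x ` S \<subseteq> {x \<in> {t 0..t m}. g x = y}"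
    proof (intro image_subsetI CollectI conjI)
      fix i assume i: "i \<in> S"
      then have "{t i..t (Suc i)} \<subseteq> {t 0..t m}" by (intro sub) (simp add: S_def)
      then show "x i \<in> {t 0..t m}" using x[OF i] by (auto dest: subsetD)
      show "g (x i) = y" using x[OF i] by simp
    qed
    then have "card S \<le> N"
      using card_mono[OF fin[of y], of "x ` S"] card_image[OF inj] card[of y] by linarith
    moreover have "(\<Sum>i<m. indicator (I i) y) = real (card S)"
      by (simp add: indicator_def S_def sum.If_cases Int_def lessThan_def)
    ultimately show ?thesis using True by simp
  qed
  have len: "measure lborel (I i) = \<bar>g (t (Suc i)) - g (t i)\<bar>" for i
    by (simp add: I_def min_def max_def)
  have int: "integrable lborel (indicator (I i) :: real \<Rightarrow> real)" for i
    by (simp add: I_def integrable_real_indicator min_def max_def)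
  \<comment> \<open>Each increment is the length of its interval of heights, so the variation is the
    integral of the number of intervals containing \<open>y\<close>.\<close>
  have "(\<Sum>i<m. \<bar>g (t (Suc i)) - g (t i)\<bar>) = integral\<^sup>L lborel (\<lambda>y. \<Sum>i<m. indicator (I i) y)"
    using int by (simp add: len)
  also have "\<dots> \<le> integral\<^sup>L lborel (\<lambda>y. (N::real) * indicator {-M..M} y)"
    using int count
    by (intro integral_mono integrable_mult_right integrable_sum integrable_real_indicator)
      (auto simp: M0)
  also have "\<dots> = 2 * M * N" using M0 by simp
  finally show ?thesis .
qed

text \<open>Buffon's needle: the projection \<open>f\<close> of the needle has the antiderivative
  \<open>F\<close>, and the integral of its absolute value is at least the variation of
  \<open>F\<close>. At a zero \<open>c\<close> of \<open>f\<close> the whole length shows up in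
  \<open>F\<close>, that is, \<open>\<bar>F c\<bar> = cmod z\<close>.\<close>

lemma twice_cmod_le_integral_projections:
  "2 * cmod z \<le> integral {0..pi} (\<lambda>\<theta>. \<bar>Re (cis (-\<theta>) * z)\<bar>)"
proof -
  define f where "f \<theta> = Re (cis (-\<theta>) * z)" for \<theta>
  define F where "F \<theta> = - Im (cis (-\<theta>) * z)" for \<theta>
  have der: "(F has_vector_derivative f \<theta>) (at \<theta> within S)" for \<theta> S
    unfolding F_def f_def has_real_derivative_iff_has_vector_derivative[symmetric]
    by (auto intro!: derivative_eq_intros)
  have int: "(f has_integral (F b - F a)) {a..b}" if "a \<le> b" for a b
    using that der by (intro fundamental_theorem_of_calculus) auto
  have cont: "continuous_on S f" for S
    unfolding f_def by (auto intro!: continuous_intros)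
  have le: "\<bar>F b - F a\<bar> \<le> integral {a..b} (\<lambda>\<theta>. \<bar>f \<theta>\<bar>)" if "a \<le> b" for a b
    using integral_norm_bound_integral[of f "{a..b}" "\<lambda>\<theta>. \<bar>f \<theta>\<bar>"] int[OF that]
    by (auto simp: integral_unique intro!: integrable_continuous_real continuous_intros cont)
  have ends: "f pi = - f 0" "F pi = - F 0"
    by (simp_all add: f_def F_def)
  have "\<exists>c\<ge>0. c \<le> pi \<and> f c = 0"
  proof (cases "f 0 \<le> 0")
    case True then show ?thesis using ends cont by (intro IVT') auto
  next
    case False then show ?thesis using ends cont by (intro IVT2') auto
  qed
  then obtain c where c: "0 \<le> c" "c \<le> pi" "f c = 0" by blast
  have "cmod z = cmod (cis (-c) * z)" by (simp add: norm_mult)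
  also have "\<dots> = \<bar>F c\<bar>" using c(3) by (simp add: f_def F_def cmod_eq_Im)
  \<comment> \<open>As \<open>F pi = - F 0\<close>, the differences \<open>F c - F 0\<close> and
    \<open>F c - F pi\<close> add up to \<open>2 * F c\<close>.\<close>
  finally have "2 * cmod z \<le> \<bar>F c - F 0\<bar> + \<bar>F pi - F c\<bar>" using ends(2) by linarith
  also have "\<dots> \<le> integral {0..c} (\<lambda>\<theta>. \<bar>f \<theta>\<bar>) + integral {c..pi} (\<lambda>\<theta>. \<bar>f \<theta>\<bar>)"
    using le c by (intro add_mono) auto
  also have "\<dots> = integral {0..pi} (\<lambda>\<theta>. \<bar>f \<theta>\<bar>)"
    using c by (intro Henstock_Kurzweil_Integration.integral_combine
        integrable_continuous_real continuous_intros cont) auto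
  finally show ?thesis unfolding f_def .
qed

section \<open>Rational functions on a real interval\<close>

lemma degree_map_poly_cnj: "degree (map_poly cnj p) = degree p"
  by (simp add: degree_map_poly)

text \<open>Twice the real part is the number plus its conjugate, so clearing denominators turns
  \<open>g x = y\<close> into a polynomial equation of degree at most \<open>2 * n\<close>. Each
  height is then crossed at most \<open>2 * n\<close> times, and the heights fill an interval of
  length at most \<open>2 * M\<close>.\<close>

lemma rational_projection_variation:
  fixes P Q :: "complex poly" and t :: "nat \<Rightarrow> real"
  assumes deg: "degree P \<le> n" "degree Q \<le> n"
    and t: "strict_mono t"
    and nz: "\<And>x. x \<in> {t 0..t m} \<Longrightarrow> poly P (of_real x) \<noteq> 0"
    and bound: "\<And>x. x \<in> {t 0..t m} \<Longrightarrow> cmod (poly Q (of_real x) / poly P (of_real x)) \<le> M"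
    and c: "cmod c = 1"
  defines "g \<equiv> \<lambda>x. Re (c * (poly Q (of_real x) / poly P (of_real x)))"
  shows "(\<Sum>i<m. \<bar>g (t (Suc i)) - g (t i)\<bar>) \<le> 4 * n * M"
proof -
  \<comment> \<open>At a real argument \<open>map_poly cnj P\<close> takes the conjugate of the
    value of \<open>P\<close>, so \<open>H y\<close> is there \<open>2 * (g x - y)\<close> times a
    value of \<open>P\<close> times its conjugate.\<close>
  define H where "H y = smult c (Q * map_poly cnj P) + smult (cnj c) (map_poly cnj Q * P)
      - smult (of_real (2 * y)) (P * map_poly cnj P)" for y :: real
  have degH: "degree (H y) \<le> 2 * n" for y
  proof -
    have "degree (A * B) \<le> 2 * n" if "degree A \<le> n" "degree B \<le> n" for A B :: "complex poly"
      using degree_mult_le[of A B] that by linarith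
    then show ?thesis unfolding H_def using deg
      by (intro degree_diff_le degree_add_le degree_smult_le[THEN order_trans])
        (auto simp: degree_map_poly_cnj)
  qed
  have root: "poly (H y) (of_real x) = 0 \<longleftrightarrow> g x = y" if "x \<in> {t 0..t m}" for x y
  proof -
    define p q where "p = poly P (of_real x)" and "q = poly Q (of_real x)"
    have p: "p \<noteq> 0" using nz[OF that] by (simp add: p_def)
    have "poly (H y) (of_real x) = p * cnj p * (c * (q / p) + cnj (c * (q / p)) - of_real (2 * y))"
      using p by (simp add: H_def p_def[symmetric] q_def[symmetric] field_simps)
    also have "c * (q / p) + cnj (c * (q / p)) = of_real (2 * g x)"
      unfolding complex_add_cnj by (simp add: g_def p_def q_def)
    finally show ?thesis using p
      by (metis complex_cnj_zero_iff diff_eq_diff_eq eq_iff_diff_eq_0 mult_cancel_left mult_eq_0_iff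
          of_real_eq_iff zero_neq_numeral)
  qed
  have mem: "t i \<in> {t 0..t m}" if "i \<le> m" for i
    using that t by (simp add: strict_mono_less_eq)
  have M0: "0 \<le> M" using bound[OF mem[of 0]] norm_ge_zero order_trans by blast
  show ?thesis
  proof (cases "\<exists>y. H y = 0")
    \<comment> \<open>A vanishing polynomial \<open>H y\<close> forces \<open>g\<close> to equal
      \<open>y\<close> on the whole interval, and a constant projection has no variation.\<close>
    case True
    then obtain y where "H y = 0" by blast
    then have "g (t i) = y" if "i \<le> m" for i using root[OF mem[OF that], of y] by simp
    then have "(\<Sum>i<m. \<bar>g (t (Suc i)) - g (t i)\<bar>) = 0" by simp
    then show ?thesis using M0 by simp
  next
    case False
    have sub: "of_real ` {x \<in> {t 0..t m}. g x = y} \<subseteq> {z. poly (H y) z = 0}" for y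
      using root by auto
    have fin: "finite {z. poly (H y) z = 0}" for y
      using False by (intro poly_roots_finite) auto
    have inj: "inj_on complex_of_real S" for S by (simp add: inj_on_def)
    have "(\<Sum>i<m. \<bar>g (t (Suc i)) - g (t i)\<bar>) \<le> 2 * M * real (2 * n)"
    proof (rule variation_le_crossings[OF t])
      show "continuous_on {t 0..t m} g"
        unfolding g_def using nz by (auto intro!: continuous_intros)
      show "\<bar>g x\<bar> \<le> M" if "x \<in> {t 0..t m}" for x
        using abs_Re_le_cmod[of "c * (poly Q (of_real x) / poly P (of_real x))"] bound[OF that] c
        unfolding g_def by (simp only: norm_mult mult_1_left)
      show "finite {x \<in> {t 0..t m}. g x = y}" for y
        using finite_subset[OF sub fin] finite_imageD inj by blast
      show "card {x \<in> {t 0..t m}. g x = y} \<le> 2 * n" for y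
      proof -
        have "card {x \<in> {t 0..t m}. g x = y} = card (complex_of_real ` {x \<in> {t 0..t m}. g x = y})"
          by (simp add: card_image inj)
        also have "\<dots> \<le> card {z. poly (H y) z = 0}" by (intro card_mono sub fin)
        also have "\<dots> \<le> degree (H y)" using False by (intro card_poly_roots_bound) auto
        finally show ?thesis using degH[of y] by linarith
      qed
    qed
    then show ?thesis by (simp add: mult_ac)
  qed
qed

text \<open>Each chord is at most half the integral of its projections over all directions. After
  exchanging sum and integral every direction contributes at most \<open>4 * n * M\<close>, and the
  directions range over an interval of length \<open>pi\<close>.\<close>

lemma Spijker_polygon:
  fixes P Q :: "complex poly" and t :: "nat \<Rightarrow> real"
  assumes deg: "degree P \<le> n" "degree Q \<le> n"
    and t: "strict_mono t"
    and nz: "\<And>x. x \<in> {t 0..t m} \<Longrightarrow> poly P (of_real x) \<noteq> 0"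
    and bound: "\<And>x. x \<in> {t 0..t m} \<Longrightarrow> cmod (poly Q (of_real x) / poly P (of_real x)) \<le> M"
  defines "r \<equiv> \<lambda>x. poly Q (of_real x) / poly P (of_real x)"
  shows "(\<Sum>i<m. cmod (r (t (Suc i)) - r (t i))) \<le> 2 * pi * n * M"
proof -
  define f where "f i \<theta> = \<bar>Re (cis (-\<theta>) * (r (t (Suc i)) - r (t i)))\<bar>" for i \<theta>
  have int: "f i integrable_on {0..pi}" for i
    unfolding f_def by (intro integrable_continuous_real continuous_intros)
  have "2 * (\<Sum>i<m. cmod (r (t (Suc i)) - r (t i))) \<le> (\<Sum>i<m. integral {0..pi} (f i))"
    unfolding sum_distrib_left f_def by (intro sum_mono twice_cmod_le_integral_projections)
  also have "\<dots> = integral {0..pi} (\<lambda>\<theta>. \<Sum>i<m. f i \<theta>)"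
    by (simp add: int integral_sum)
  also have "\<dots> \<le> integral {0..pi} (\<lambda>\<theta>. 4 * n * M)"
  proof (intro integral_le integrable_sum)
    fix \<theta> :: real
    show "(\<Sum>i<m. f i \<theta>) \<le> 4 * n * M"
      using rational_projection_variation[OF deg t nz bound, of m "cis (-\<theta>)"]
      by (simp add: f_def r_def right_diff_distrib)
  qed (auto simp: int)
  also have "\<dots> = pi * (4 * n * M)" by simp
  finally show ?thesis by (simp add: mult_ac)
qed

text \<open>By uniform continuity the derivative is nearly constant on each piece of a fine mesh, so
  a chord is almost as long as its arc. This carries a bound for all inscribed polygons over to the
  arc length.\<close>

lemma integral_norm_derivative_le_polygons:
  fixes \<gamma> :: "real \<Rightarrow> complex"
  assumes der: "\<And>x. x \<in> {0..1} \<Longrightarrow> (\<gamma> has_vector_derivative \<gamma>' x) (at x within {0..1})"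
    and cont: "continuous_on {0..1} \<gamma>'"
    and poly: "\<And>m. m > 0 \<Longrightarrow> (\<Sum>i<m. cmod (\<gamma> (real (Suc i) / m) - \<gamma> (real i / m))) \<le> L"
  shows "integral {0..1} (\<lambda>x. cmod (\<gamma>' x)) \<le> L"
proof (rule field_le_epsilon)
  fix e :: real assume e: "e > 0"
  have "uniformly_continuous_on {0..1} \<gamma>'"
    using cont by (intro compact_uniformly_continuous) auto
  then obtain d where d: "d > 0"
    "\<And>x y. \<lbrakk>x \<in> {0..1}; y \<in> {0..1}; dist y x < d\<rbrakk> \<Longrightarrow> dist (\<gamma>' y) (\<gamma>' x) < e / 2"
    unfolding uniformly_continuous_on_def using e by (meson half_gt_zero)
  obtain m :: nat where "1 / d < m" using reals_Archimedean2 by blast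
  with d(1) have "1 < m * d" by (simp add: field_simps)
  moreover from this have m: "m > 0" by (cases m) auto
  ultimately have md: "1 / m < d" by (simp add: pos_divide_less_eq mult.commute)
  define t where "t i = real i / m" for i
  have tm: "t (Suc i) - t i = 1 / m" for i by (simp add: t_def diff_divide_distrib[symmetric])
  have t01: "t i \<in> {0..1}" if "i \<le> m" for i using that m by (simp add: t_def field_simps)
  have mono: "t i \<le> t (Suc i)" for i by (simp add: t_def divide_right_mono)
  \<comment> \<open>The error has two halves: one from comparing the chord with
    \<open>\<gamma>' (t i)\<close> times the step, one from comparing the integrand with its value
    at \<open>t i\<close>.\<close>
  have piece: "integral {t i..t (Suc i)} (\<lambda>x. cmod (\<gamma>' x)) \<le> cmod (\<gamma> (t (Suc i)) - \<gamma> (t i)) + e * (1 / m)"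
    if i: "i < m" for i
  proof -
    let ?I = "{t i..t (Suc i)}"
    have sub: "?I \<subseteq> {0..1}" using t01[of i] t01[of "Suc i"] i by auto
    have c': "continuous_on ?I \<gamma>'" using cont sub continuous_on_subset by blast
    have "((\<lambda>x. \<gamma>' x) has_integral (\<gamma> (t (Suc i)) - \<gamma> (t i))) ?I"
      using mono
      by (intro fundamental_theorem_of_calculus)
        (auto intro!: has_vector_derivative_within_subset[OF der sub] subsetD[OF sub])
    moreover have "((\<lambda>x. \<gamma>' (t i)) has_integral (1/m) *\<^sub>R \<gamma>' (t i)) ?I"
      using has_integral_const_real[of "\<gamma>' (t i)" "t i" "t (Suc i)"] mono[of i] tm[of i] by simp
    ultimately have "((\<lambda>x. \<gamma>' x - \<gamma>' (t i)) has_integral (\<gamma> (t (Suc i)) - \<gamma> (t i) - (1/m) *\<^sub>R \<gamma>' (t i))) ?I"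
      by (rule has_integral_diff)
    moreover have close: "cmod (\<gamma>' x - \<gamma>' (t i)) \<le> e / 2" if "x \<in> ?I" for x
    proof -
      have "dist x (t i) < d" using that tm[of i] md by (auto simp: dist_real_def)
      then show ?thesis
        using d(2)[of "t i" x] t01[of i] i that sub by (auto simp: dist_norm intro: less_imp_le)
    qed
    ultimately have "cmod (\<gamma> (t (Suc i)) - \<gamma> (t i) - (1/m) *\<^sub>R \<gamma>' (t i))
        \<le> e / 2 * measure lborel {t i..t (Suc i)}"
      using e by (intro has_integral_bound_real[of "e/2" "{}"]) auto
    then have "cmod (\<gamma> (t (Suc i)) - \<gamma> (t i) - (1/m) *\<^sub>R \<gamma>' (t i)) \<le> e / 2 * (1 / m)"
      using mono[of i] tm[of i] by simp
    then have 1: "(1/m) * cmod (\<gamma>' (t i)) \<le> cmod (\<gamma> (t (Suc i)) - \<gamma> (t i)) + e / 2 * (1/m)"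
      using norm_triangle_ineq3[of "\<gamma> (t (Suc i)) - \<gamma> (t i)" "(1/m) *\<^sub>R \<gamma>' (t i)"] m by (simp add: norm_minus_commute)
    have "integral ?I (\<lambda>x. cmod (\<gamma>' x)) \<le> integral ?I (\<lambda>x. cmod (\<gamma>' (t i)) + e / 2)"
    proof (intro integral_le)
      show "(\<lambda>x. cmod (\<gamma>' x)) integrable_on ?I"
        by (intro integrable_continuous_real continuous_intros c')
      show "cmod (\<gamma>' x) \<le> cmod (\<gamma>' (t i)) + e / 2" if "x \<in> ?I" for x
        using norm_triangle_sub[of "\<gamma>' x" "\<gamma>' (t i)"] close[OF that] by linarith
    qed auto
    also have "\<dots> = (1/m) * cmod (\<gamma>' (t i)) + e / 2 * (1/m)"
      using mono[of i] tm[of i] by (simp add: algebra_simps)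
    finally show ?thesis using 1 by simp
  qed
  have split: "integral {0..t k} (\<lambda>x. cmod (\<gamma>' x)) = (\<Sum>i<k. integral {t i..t (Suc i)} (\<lambda>x. cmod (\<gamma>' x)))"
    if "k \<le> m" for k
    using that
  proof (induction k)
    case 0 then show ?case by (simp add: t_def)
  next
    case (Suc k)
    have "(\<lambda>x. cmod (\<gamma>' x)) integrable_on {0..t (Suc k)}"
      using t01[OF Suc.prems]
      by (intro integrable_continuous_real continuous_intros continuous_on_subset[OF cont]) auto
    then have "integral {0..t k} (\<lambda>x. cmod (\<gamma>' x)) + integral {t k..t (Suc k)} (\<lambda>x. cmod (\<gamma>' x))
        = integral {0..t (Suc k)} (\<lambda>x. cmod (\<gamma>' x))"
      using mono t01[of k] Suc.prems
      by (intro Henstock_Kurzweil_Integration.integral_combine) auto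
    with Suc show ?case by simp
  qed
  have "integral {0..1} (\<lambda>x. cmod (\<gamma>' x)) = (\<Sum>i<m. integral {t i..t (Suc i)} (\<lambda>x. cmod (\<gamma>' x)))"
    using split[of m] m by (simp add: t_def)
  also have "\<dots> \<le> (\<Sum>i<m. cmod (\<gamma> (t (Suc i)) - \<gamma> (t i)) + e * (1 / m))"
    by (intro sum_mono piece) auto
  also have "\<dots> = (\<Sum>i<m. cmod (\<gamma> (t (Suc i)) - \<gamma> (t i))) + e"
    using m by (simp add: sum.distrib)
  also have "\<dots> \<le> L + e" using poly[OF m] by (simp add: t_def)
  finally show "integral {0..1} (\<lambda>x. cmod (\<gamma>' x)) \<le> L + e" .
qed

subsection \<open>Singular values and the operator norm\<close>

lemma norm_scalar_mult_complex: "norm (c *s (x :: complex^'n)) = cmod c * norm x"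
  by (simp add: norm_vec_def L2_set_def norm_mult power_mult_distrib real_sqrt_mult
      sum_distrib_left[symmetric])

text \<open>The inner product here is the real one, the real part of the Hermitian product. The
  conjugate transpose is the adjoint for it as well, so real orthogonality arguments apply to
  singular values.\<close>

lemma inner_conj_transpose:
  fixes M :: "complex^'n^'m"
  shows "inner (conj_transpose M *v x) y = inner x (M *v y)"
proof -
  have "inner (conj_transpose M *v x) y = (\<Sum>i\<in>UNIV. \<Sum>j\<in>UNIV. inner (cnj (M$j$i) * x$j) (y$i))"
    by (simp add: inner_vec_def matrix_vector_mult_def conj_transpose_def transpose_def inner_sum_left)
  also have "\<dots> = (\<Sum>j\<in>UNIV. \<Sum>i\<in>UNIV. inner (cnj (M$j$i) * x$j) (y$i))"
    by (rule sum.swap)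
  also have "\<dots> = inner x (M *v y)"
    by (simp add: inner_vec_def matrix_vector_mult_def inner_sum_right)
      (simp add: inner_complex_def algebra_simps)
  finally show ?thesis .
qed

lemma of_real_scalar_mult: "(complex_of_real a) *s (x :: complex^'n) = a *\<^sub>R x"
  by (simp add: vec_eq_iff scaleR_conv_of_real[where 'a = complex])

lemma singular_values_iff:
  "s \<in> singular_values M \<longleftrightarrow> 0 \<le> s \<and> (\<exists>v. v \<noteq> 0 \<and> conj_transpose M *v (M *v v) = s\<^sup>2 *\<^sub>R v)"
  by (simp add: singular_values_def mat_eigenvalue_def of_real_scalar_mult matrix_vector_mul_assoc
      del: of_real_power)

lemma singular_value_norm:
  assumes "s \<ge> 0" "conj_transpose M *v (M *v v) = s\<^sup>2 *\<^sub>R v"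
  shows "norm (M *v v) = s * norm v"
proof -
  have "(norm (M *v v))\<^sup>2 = (s * norm v)\<^sup>2"
    using inner_conj_transpose[of M "M *v v" v] assms
    by (simp add: power2_norm_eq_inner power_mult_distrib)
  then show ?thesis using assms(1) by (simp add: power2_eq_iff_nonneg)
qed

text \<open>Eigenvectors for different singular values are orthogonal, hence independent, and the
  space has finite dimension. Finiteness is what gives the \<open>Max\<close> in
  \<open>max_singular_value\<close> its meaning.\<close>

lemma finite_singular_values: "finite (singular_values (M :: complex^'n^'m))"
proof -
  define v where "v s = (SOME v. v \<noteq> 0 \<and> conj_transpose M *v (M *v v) = s\<^sup>2 *\<^sub>R v)" for s :: real
  have v: "v s \<noteq> 0" "conj_transpose M *v (M *v v s) = s\<^sup>2 *\<^sub>R v s"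
    if "s \<in> singular_values M" for s
    using someI_ex[of "\<lambda>v. v \<noteq> 0 \<and> conj_transpose M *v (M *v v) = s\<^sup>2 *\<^sub>R v"] that
    by (auto simp: singular_values_iff v_def)
  have orth: "inner (v s) (v t) = 0"
    if "s \<in> singular_values M" "t \<in> singular_values M" "s \<noteq> t" for s t
  proof -
    have "s\<^sup>2 * inner (v s) (v t) = t\<^sup>2 * inner (v s) (v t)"
      using inner_conj_transpose[of M "M *v v s" "v t"] inner_conj_transpose[of M "M *v v t" "v s"]
        v[OF that(1)] v[OF that(2)] by (simp add: inner_commute)
    moreover have "s\<^sup>2 \<noteq> t\<^sup>2"
      using that by (auto simp: singular_values_def power2_eq_iff_nonneg)
    ultimately show ?thesis by simp
  qed
  have "inj_on v (singular_values M)"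
    using orth v(1) by (metis inj_onI inner_eq_zero_iff)
  moreover have "independent (v ` singular_values M)"
    using orth v(1)
    by (intro pairwise_orthogonal_independent) (auto simp: pairwise_def orthogonal_def)
  ultimately show ?thesis using finite_imageD independent_imp_finite by blast
qed

text \<open>Let \<open>v\<close> maximise \<open>norm (M *v x)\<close> on the unit sphere, with
  maximum \<open>s\<close>. The quadratic form \<open>q\<close> is nonnegative and vanishes at
  \<open>v\<close>, so its gradient vanishes there too, which is the eigenvalue equation for
  \<open>s\<^sup>2\<close>.\<close>

lemma operator_norm_singular_value:
  fixes M :: "complex^'n^'m"
  obtains v where "norm v = 1" "norm (M *v v) \<in> singular_values M"
    "\<And>x. norm (M *v x) \<le> norm (M *v v) * norm x"
proof -
  have "continuous_on (sphere 0 1) (\<lambda>x. norm (M *v x))"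
    by (intro continuous_intros linear_continuous_on matrix_vector_mul_bounded_linear)
  moreover have "sphere 0 1 \<noteq> ({} :: (complex^'n) set)" by simp
  ultimately obtain v where v: "norm v = 1" and max: "\<And>x. norm x = 1 \<Longrightarrow> norm (M *v x) \<le> norm (M *v v)"
    using continuous_attains_sup[OF compact_sphere, of "0 :: complex^'n" 1 "\<lambda>x. norm (M *v x)"]
    by auto
  define s where "s = norm (M *v v)"
  have scale: "M *v (a *\<^sub>R x) = a *\<^sub>R (M *v x)" for a x
    using linear_scale[OF matrix_vector_mul_linear] .
  have le: "norm (M *v x) \<le> s * norm x" for x
  proof (cases "x = 0")
    case False
    then have "norm (M *v ((1 / norm x) *\<^sub>R x)) \<le> s" unfolding s_def by (intro max) simp
    with False show ?thesis by (simp only: scale) (simp add: field_simps)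
  qed simp
  \<comment> \<open>Half the gradient of \<open>q\<close> at \<open>v\<close>; a step from
    \<open>v\<close> along \<open>w\<close> tests the minimum.\<close>
  define w where "w = s\<^sup>2 *\<^sub>R v - conj_transpose M *v (M *v v)"
  define q where "q x = s\<^sup>2 * inner x x - inner (M *v x) (M *v x)" for x
  have q0: "0 \<le> q x" for x
    using power_mono[OF le[of x], of 2] by (simp add: q_def power_mult_distrib power2_norm_eq_inner)
  have qv: "q v = 0" using v by (simp add: q_def s_def power2_norm_eq_inner[symmetric])
  have expand: "q (v + e *\<^sub>R w) = q v + 2 * e * inner w w + e\<^sup>2 * q w" for e
  proof -
    have "inner w w = s\<^sup>2 * inner v w - inner (M *v v) (M *v w)"
      by (subst (1) w_def) (simp add: inner_diff_left inner_conj_transpose)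
    moreover have "q (v + e *\<^sub>R w)
        = q v + 2 * e * (s\<^sup>2 * inner v w - inner (M *v v) (M *v w)) + e\<^sup>2 * q w"
      by (simp add: q_def matrix_vector_right_distrib scale inner_add_left inner_add_right
          inner_commute power2_eq_square algebra_simps)
    ultimately show ?thesis by simp
  qed
  have "inner w w = 0"
  proof (rule ccontr)
    assume "inner w w \<noteq> 0"
    then have pos: "inner w w > 0" by simp
    \<comment> \<open>The minimiser of \<open>2 * e * inner w w + e\<^sup>2 * (q w + 1)\<close>; the
      added 1 keeps the denominator positive when \<open>q w = 0\<close>.\<close>
    define e where "e = - inner w w / (q w + 1)"
    have "0 \<le> 2 * e * inner w w + e\<^sup>2 * q w"
      using q0[of "v + e *\<^sub>R w"] expand[of e] qv by simp
    also have "\<dots> \<le> 2 * e * inner w w + e\<^sup>2 * (q w + 1)"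
      by (intro add_left_mono mult_left_mono) auto
    also have "\<dots> = - ((inner w w)\<^sup>2 / (q w + 1))"
      using q0[of w] by (simp add: e_def power2_eq_square add_nonneg_eq_0_iff)
    also have "\<dots> < 0" using q0[of w] pos by (simp add: add_nonneg_pos)
    finally show False by simp
  qed
  then have "conj_transpose M *v (M *v v) = s\<^sup>2 *\<^sub>R v" by (simp add: w_def)
  moreover have "v \<noteq> 0" using v by auto
  ultimately have "s \<in> singular_values M" by (auto simp: singular_values_iff s_def)
  with v le that show thesis by (auto simp: s_def)
qed

text \<open>Identifies the largest singular value, defined through eigenvalues, with the operator
  norm: the latter is a singular value, and every singular value is the factor by which
  \<open>M\<close> stretches an eigenvector.\<close>

lemma max_singular_value_attained:
  fixes M :: "complex^'n^'m"
  obtains v where "norm v = 1" "norm (M *v v) = max_singular_value M"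
    "\<And>x. norm (M *v x) \<le> max_singular_value M * norm x"
proof -
  obtain v where v: "norm v = 1" "norm (M *v v) \<in> singular_values M"
    "\<And>x. norm (M *v x) \<le> norm (M *v v) * norm x"
    using operator_norm_singular_value by blast
  have "s \<le> norm (M *v v)" if s: "s \<in> singular_values M" for s
  proof -
    obtain x where x: "x \<noteq> 0" "conj_transpose M *v (M *v x) = s\<^sup>2 *\<^sub>R x" "s \<ge> 0"
      using s by (auto simp: singular_values_iff)
    show ?thesis using singular_value_norm[OF x(3,2)] v(3)[of x] x(1) by simp
  qed
  then have "max_singular_value M = norm (M *v v)"
    unfolding max_singular_value_def using v(2) finite_singular_values by (intro Max_eqI) auto
  with v that show thesis by simp
qed

lemma max_singular_value_nonneg: "0 \<le> max_singular_value M"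
  by (metis max_singular_value_attained norm_ge_zero)

lemma norm_mult_le_max_singular_value: "norm (M *v x) \<le> max_singular_value M * norm x"
  using max_singular_value_attained by blast

text \<open>Bilinear, not sesquilinear: no conjugation in the first argument.\<close>

definition cdot :: "complex^'n \<Rightarrow> complex^'n \<Rightarrow> complex" where
  "cdot u x = (\<Sum>i\<in>UNIV. u$i * x$i)"

lemma cmod_cdot_le: "cmod (cdot u x) \<le> norm u * norm x"
proof -
  have "cmod (cdot u x) \<le> (\<Sum>i\<in>UNIV. \<bar>cmod (u$i)\<bar> * \<bar>cmod (x$i)\<bar>)"
    unfolding cdot_def by (intro sum_norm_le) (simp add: norm_mult)
  also have "\<dots> \<le> norm u * norm x"
    unfolding norm_vec_def by (rule L2_set_mult_ineq)
  finally show ?thesis .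
qed

lemma linear_functional_cdot:
  shows cdot_add: "cdot u (x + y) = cdot u x + cdot u y"
    and cdot_diff: "cdot u (x - y) = cdot u x - cdot u y"
    and cdot_scale: "cdot u (c *s x) = c * cdot u x"
  by (simp_all add: cdot_def algebra_simps sum.distrib sum_subtractf sum_distrib_left)

lemma cdot_matrix: "cdot u (M *v x) = cdot (transpose M *v u) x"
proof -
  have "cdot u (M *v x) = (\<Sum>i\<in>UNIV. \<Sum>j\<in>UNIV. u$i * M$i$j * x$j)"
    by (simp add: cdot_def matrix_vector_mult_def sum_distrib_left mult_ac)
  also have "\<dots> = (\<Sum>j\<in>UNIV. \<Sum>i\<in>UNIV. u$i * M$i$j * x$j)" by (rule sum.swap)
  also have "\<dots> = cdot (transpose M *v u) x"
    by (simp add: cdot_def matrix_vector_mult_def transpose_def sum_distrib_left mult_ac)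
  finally show ?thesis .
qed

lemma cdot_conj_self: "cdot (\<chi> i. cnj (x$i)) x = of_real ((norm x)\<^sup>2)"
  by (simp add: cdot_def norm_vec_def L2_set_def sum_nonneg complex_norm_square mult.commute
      del: of_real_power)

lemma norm_cnj_vec: "norm (\<chi> i. cnj (x$i)) = norm (x :: complex^'n)"
  by (simp add: norm_vec_def)

text \<open>For \<open>x = 0\<close> the division by zero makes the functional zero, hence
  \<open>norm u \<le> 1\<close> in place of equality.\<close>

lemma norming_functional:
  obtains u where "norm u \<le> 1" "cdot u x = of_real (norm x)"
proof
  let ?u = "(1 / norm x) *\<^sub>R (\<chi> i. cnj (x$i))"
  show "norm ?u \<le> 1" by (simp add: norm_cnj_vec)
  have "cdot ?u x = (1 / norm x) *\<^sub>R cdot (\<chi> i. cnj (x$i)) x"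
    by (simp add: cdot_def scaleR_sum_right)
  then show "cdot ?u x = of_real (norm x)"
    unfolding cdot_conj_self by (simp add: power2_eq_square scaleR_conv_of_real)
qed

subsection \<open>The resolvent\<close>

definition resolvent :: "complex^'n^'n \<Rightarrow> complex \<Rightarrow> complex^'n^'n" where
  "resolvent A z = matrix_inv (mat z - A)"

text \<open>The power series of \<open>u\<^sup>T e\<^bsup>tA\<^esup> v\<close>.\<close>

definition impulse :: "complex^'n^'n \<Rightarrow> complex^'n \<Rightarrow> complex^'n \<Rightarrow> complex \<Rightarrow> complex" where
  "impulse A u v t = (\<Sum>k. cdot u (((*v) A ^^ k) v) / fact k * t ^ k)"

section \<open>Invertibility, Neumann expansion and rationality of the resolvent\<close>

lemma mat_minus_mult: "(mat z - (A :: complex^'n^'n)) *v x = z *s x - A *v x"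
  by (simp add: mat_def matrix_vector_mult_def vec_eq_iff left_diff_distrib sum_subtractf
      mult_delta_left)

lemma singular_imp_mat_eigenvalue:
  assumes "det (mat z - A) = 0"
  shows "mat_eigenvalue A z"
proof -
  have "\<not> invertible (mat z - A)" using assms by (simp add: invertible_det_nz)
  then obtain x where "x \<noteq> 0" "(mat z - A) *v x = 0"
    by (auto simp: invertible_left_inverse matrix_left_invertible_ker)
  then show ?thesis by (auto simp: mat_eigenvalue_def mat_minus_mult)
qed

lemma resolvent_inverse:
  assumes "det (mat z - A) \<noteq> 0"
  shows resolvent_right: "(mat z - A) *v (resolvent A z *v x) = x"
    and resolvent_left: "resolvent A z *v ((mat z - A) *v x) = x"
proof -
  have "\<exists>B. (mat z - A) ** B = mat 1 \<and> B ** (mat z - A) = mat 1"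
    using assms by (simp add: invertible_det_nz[symmetric] invertible_def)
  then have "(mat z - A) ** resolvent A z = mat 1 \<and> resolvent A z ** (mat z - A) = mat 1"
    unfolding resolvent_def matrix_inv_def by (rule someI_ex)
  then show "(mat z - A) *v (resolvent A z *v x) = x" "resolvent A z *v ((mat z - A) *v x) = x"
    by (simp_all add: matrix_vector_mul_assoc)
qed

lemma matrix_bound:
  fixes A :: "complex^'n^'m"
  obtains a where "a > 0" "\<And>x. norm (A *v x) \<le> a * norm x"
  using bounded_linear.pos_bounded[OF matrix_vector_mul_bounded_linear, of A]
  by (metis mult.commute)

lemma norm_funpow_matrix:
  fixes A :: "complex^'n^'n"
  assumes "a > 0" "\<And>x. norm (A *v x) \<le> a * norm x"
  shows "norm (((*v) A ^^ k) v) \<le> a ^ k * norm v"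
proof (induction k)
  case (Suc k)
  have "norm (((*v) A ^^ Suc k) v) \<le> a * norm (((*v) A ^^ k) v)" using assms by simp
  also have "\<dots> \<le> a * (a ^ k * norm v)" using Suc assms(1) by (intro mult_left_mono) auto
  finally show ?case by simp
qed simp

lemma det_ne_0_of_large:
  fixes A :: "complex^'n^'n"
  assumes A: "\<And>x. norm (A *v x) \<le> a * norm x" and z: "cmod z > a"
  shows "det (mat z - A) \<noteq> 0"
proof
  assume "det (mat z - A) = 0"
  then obtain x where x: "x \<noteq> 0" "A *v x = z *s x"
    using singular_imp_mat_eigenvalue unfolding mat_eigenvalue_def by blast
  then have "cmod z * norm x \<le> a * norm x" using A[of x] by (simp add: norm_scalar_mult_complex)
  with x(1) z show False by simp
qed

lemma norm_resolvent_le: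
  assumes A: "\<And>x. norm (A *v x) \<le> a * norm x" and z: "cmod z > a"
  shows "norm (resolvent A z *v x) \<le> norm x / (cmod z - a)"
proof -
  define y where "y = resolvent A z *v x"
  have "z *s y = x + A *v y"
    using resolvent_right[OF det_ne_0_of_large[OF assms], of x]
    unfolding mat_minus_mult y_def[symmetric] by (simp only: diff_eq_eq)
  then have "cmod z * norm y \<le> norm x + a * norm y"
    using norm_triangle_ineq[of x "A *v y"] A[of y] by (metis add_left_mono norm_scalar_mult_complex order_trans)
  with z show ?thesis unfolding y_def[symmetric] by (simp add: field_simps)
qed

text \<open>Finite Neumann series, from iterating
  \<open>(zI - A)^(-1) w = w / z + (zI - A)^(-1) A w / z\<close>. The exact remainder can be
  estimated uniformly on a circle, so no limit has to be taken under the integral.\<close>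

lemma resolvent_expansion:
  assumes det: "det (mat z - A) \<noteq> 0" and z: "z \<noteq> 0"
  shows "cdot u (resolvent A z *v v)
    = (\<Sum>k<m. cdot u (((*v) A ^^ k) v) / z ^ Suc k) + cdot u (resolvent A z *v (((*v) A ^^ m) v)) / z ^ m"
proof (induction m)
  case (Suc m)
  define w where "w = ((*v) A ^^ m) v"
  have "z *s (resolvent A z *v w) = w + resolvent A z *v (A *v w)"
    using resolvent_left[OF det, of w]
    unfolding mat_minus_mult matrix_vector_mult_diff_distrib vec.scale by (simp only: diff_eq_eq)
  then have "z * cdot u (resolvent A z *v w) = cdot u w + cdot u (resolvent A z *v (A *v w))"
    by (metis cdot_add cdot_scale)
  then have "cdot u (resolvent A z *v w) / z ^ m
      = cdot u w / z ^ Suc m + cdot u (resolvent A z *v (A *v w)) / z ^ Suc m"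
    using z by (simp add: field_simps)
  with Suc show ?case by (simp add: w_def)
qed simp

lemma degree_det_le:
  fixes N :: "complex poly^'n^'n"
  assumes "\<And>i j. degree (N$i$j) \<le> 1"
  shows "degree (det N) \<le> CARD('n)"
  unfolding det_def
proof (intro degree_sum_le finite_permutations finite)
  fix p
  have "degree (\<Prod>i\<in>UNIV. N $ i $ p i) \<le> (\<Sum>i\<in>UNIV. degree (N $ i $ p i))"
    using degree_prod_sum_le[of "UNIV :: 'n set" "\<lambda>i. N $ i $ p i"] by (simp add: o_def)
  also have "\<dots> \<le> (\<Sum>i\<in>(UNIV::'n set). 1)" by (intro sum_mono assms)
  also have "\<dots> = CARD('n)" by simp
  finally show "degree (of_int (sign p) * (\<Prod>i\<in>UNIV. N $ i $ p i)) \<le> CARD('n)"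
    using degree_mult_le[of "of_int (sign p)" "\<Prod>i\<in>UNIV. N $ i $ p i"] by simp
qed

lemma poly_det: "poly (det N) z = det (map_matrix (\<lambda>p. poly p z) N)"
  by (simp add: det_def poly_sum poly_prod)

text \<open>Cramer's rule: \<open>P\<close> is the characteristic polynomial, and \<open>Q\<close>
  combines with weights \<open>u$k\<close> the determinants in which column \<open>k\<close> is
  replaced by \<open>v\<close>. Matrix entries of degree at most one give the degree bounds.\<close>

lemma resolvent_rational:
  fixes A :: "complex^'n^'n"
  obtains P Q where "degree P \<le> CARD('n)" "degree Q \<le> CARD('n)"
    "\<And>z. poly P z = det (mat z - A)"
    "\<And>z. poly P z \<noteq> 0 \<Longrightarrow> cdot u (resolvent A z *v v) = poly Q z / poly P z"
proof
  define N :: "complex poly^'n^'n" where "N = (\<chi> i j. [:- A$i$j, if i = j then 1 else 0:])"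
  define N' where "N' k = (\<chi> i j. if j = k then [:v$i:] else N$i$j)" for k
  have N: "map_matrix (\<lambda>p. poly p z) N = mat z - A" for z
    by (simp add: N_def vec_eq_iff mat_def)
  have N': "map_matrix (\<lambda>p. poly p z) (N' k) = (\<chi> i j. if j = k then v$i else (mat z - A)$i$j)" for z k
    unfolding N'_def N[symmetric] by (simp add: vec_eq_iff)
  show "degree (det N) \<le> CARD('n)" by (intro degree_det_le) (simp add: N_def)
  have "degree (det (N' k)) \<le> CARD('n)" for k
    by (intro degree_det_le) (simp add: N'_def N_def)
  then show "degree (\<Sum>k\<in>UNIV. smult (u$k) (det (N' k))) \<le> CARD('n)"
    by (intro degree_sum_le finite order_trans[OF degree_smult_le])
  show P: "poly (det N) z = det (mat z - A)" for z by (simp add: poly_det N)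
  show "cdot u (resolvent A z *v v) = poly (\<Sum>k\<in>UNIV. smult (u$k) (det (N' k))) z / poly (det N) z"
    if "poly (det N) z \<noteq> 0" for z
  proof -
    have d: "det (mat z - A) \<noteq> 0" using that P by simp
    have "resolvent A z *v v
        = (\<chi> k. det (\<chi> i j. if j = k then v$i else (mat z - A)$i$j) / det (mat z - A))"
      using resolvent_right[OF d, of v] by (simp only: cramer[OF d])
    then show ?thesis
      by (simp add: cdot_def poly_sum poly_det N N' sum_divide_distrib)
  qed
qed

section \<open>The impulse series and its contour integral\<close>

lemma impulse_sums:
  fixes A :: "complex^'n^'n"
  shows "(\<lambda>k. cdot u (((*v) A ^^ k) v) / fact k * t ^ k) sums impulse A u v t"
proof -
  obtain a where a: "a > 0" "\<And>x. norm (A *v x) \<le> a * norm x" using matrix_bound by blast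
  have "norm (cdot u (((*v) A ^^ k) v) / fact k * t ^ k) \<le> norm u * norm v * ((a * cmod t) ^ k /\<^sub>R fact k)" for k
  proof -
    have "cmod (cdot u (((*v) A ^^ k) v)) \<le> norm u * (a ^ k * norm v)"
      using cmod_cdot_le[of u "((*v) A ^^ k) v"] norm_funpow_matrix[OF a, of k v]
      by (meson mult_left_mono norm_ge_zero order_trans)
    then have "cmod (cdot u (((*v) A ^^ k) v)) * (cmod t ^ k / fact k)
        \<le> norm u * (a ^ k * norm v) * (cmod t ^ k / fact k)"
      by (rule mult_right_mono) simp
    then show ?thesis by (simp add: norm_mult norm_divide norm_power power_mult_distrib field_simps)
  qed
  moreover have "summable (\<lambda>k. norm u * norm v * ((a * cmod t) ^ k /\<^sub>R fact k))"
    by (rule summable_mult[OF summable_exp_generic])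
  ultimately have "summable (\<lambda>k. cdot u (((*v) A ^^ k) v) / fact k * t ^ k)"
    by (rule summable_comparison_test'[rotated])
  then show ?thesis unfolding impulse_def by (rule summable_sums)
qed

lemma higher_deriv_exp_mult: "(deriv ^^ k) (\<lambda>z. exp (z * t)) = (\<lambda>z::complex. t ^ k * exp (z * t))"
proof (induction k)
  case (Suc k)
  have "deriv (\<lambda>z. t ^ k * exp (z * t)) z = t ^ Suc k * exp (z * t)" for z
    by (rule DERIV_imp_deriv) (auto intro!: derivative_eq_intros)
  with Suc show ?case by auto
qed simp

text \<open>The circle surrounds the disc of radius \<open>a\<close>, which contains the spectrum.
  Once the Neumann sum is inserted, Cauchy's formula for the derivatives of
  \<open>exp (z * t)\<close> at 0 yields the terms of the impulse series, while the remainder decays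
  geometrically.\<close>

lemma impulse_circle_integral:
  fixes A :: "complex^'n^'n"
  assumes A: "a > 0" "\<And>x. norm (A *v x) \<le> a * norm x"
    and R: "\<sigma> \<ge> 0" "R > \<sigma> + a"
    and int: "((\<lambda>z. exp (z * t) * cdot u (resolvent A z *v v)) has_contour_integral I) (circlepath (of_real \<sigma>) R)"
  shows "I = 2 * pi * \<i> * impulse A u v t"
proof -
  define c where "c k = cdot u (((*v) A ^^ k) v)" for k
  \<comment> \<open>On the circle \<open>cmod z\<close> is at least \<open>b\<close>, so
    \<open>a / b < 1\<close> is the ratio in the remainder estimate.\<close>
  define b where "b = R - \<sigma>"
  have b: "b > a" using R by (simp add: b_def)
  have far: "cmod z \<ge> b" if "cmod (z - of_real \<sigma>) = R" for z
    using norm_triangle_ineq2[of "z - of_real \<sigma>" "- of_real \<sigma>"] that R by (simp add: b_def)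
  have summand: "((\<lambda>z. c k * (exp (z * t) / z ^ Suc k)) has_contour_integral
      c k * (2 * pi * \<i> / fact k * t ^ k)) (circlepath (of_real \<sigma>) R)" for k
  proof (intro has_contour_integral_lmul)
    have "((\<lambda>z. exp (z * t) / (z - 0) ^ Suc k) has_contour_integral
        (2 * pi * \<i> / fact k * (deriv ^^ k) (\<lambda>z. exp (z * t)) 0)) (circlepath (of_real \<sigma>) R)"
      using R A(1)
      by (intro Cauchy_has_contour_integral_higher_derivative_circlepath)
        (auto intro!: continuous_intros holomorphic_intros)
    then show "((\<lambda>z. exp (z * t) / z ^ Suc k) has_contour_integral
        2 * pi * \<i> / fact k * t ^ k) (circlepath (of_real \<sigma>) R)"
      by (simp add: higher_deriv_exp_mult)
  qed
  define S where "S m = (\<Sum>k<m. c k * (2 * pi * \<i> / fact k * t ^ k))" for m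
  define E where "E = exp ((R + \<sigma>) * cmod t)"
  have bound: "cmod (I - S m) \<le> E * (norm u * norm v / (b - a)) * (2 * pi * R) * (a / b) ^ m" for m
  proof -
    have "((\<lambda>z. exp (z * t) * cdot u (resolvent A z *v v) - (\<Sum>k<m. c k * (exp (z * t) / z ^ Suc k)))
        has_contour_integral (I - S m)) (circlepath (of_real \<sigma>) R)"
      unfolding S_def by (intro has_contour_integral_diff int has_contour_integral_sum summand) auto
    then have "cmod (I - S m) \<le> E * (norm u * norm v / (b - a) * (a / b) ^ m) * (2 * pi * R)"
    proof (rule has_contour_integral_bound_circlepath)
      show "0 \<le> E * (norm u * norm v / (b - a) * (a / b) ^ m)" "0 < R"
        using A b R by (simp_all add: E_def)
      fix z assume z: "cmod (z - of_real \<sigma>) = R"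
      have bz: "b \<le> cmod z" using far[OF z] .
      then have z0: "z \<noteq> 0" using b A(1) by auto
      have za: "cmod z > a" using bz b by linarith
      have "cmod z \<le> R + \<sigma>" using norm_triangle_sub[of z "of_real \<sigma>"] z R by simp
      then have E: "cmod (exp (z * t)) \<le> E"
        using complex_Re_le_cmod[of "z * t"] mult_right_mono[of "cmod z" "R + \<sigma>" "cmod t"]
        by (simp add: norm_exp_eq_Re E_def norm_mult)
      define w where "w = ((*v) A ^^ m) v"
      have "cmod (cdot u (resolvent A z *v w)) \<le> norm u * (norm w / (cmod z - a))"
        using cmod_cdot_le[of u "resolvent A z *v w"] norm_resolvent_le[OF A(2) za, of w]
        by (meson mult_left_mono norm_ge_zero order_trans)
      also have "\<dots> \<le> norm u * (a ^ m * norm v / (b - a))"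
        using norm_funpow_matrix[OF A, of m v] b bz A(1)
        by (intro mult_left_mono frac_le) (auto simp: w_def)
      finally have w: "cmod (cdot u (resolvent A z *v w)) \<le> norm u * (a ^ m * norm v / (b - a))" .
      have "cmod (cdot u (resolvent A z *v w) / z ^ m) \<le> norm u * (a ^ m * norm v / (b - a)) / b ^ m"
        unfolding norm_divide norm_power using w bz b A(1)
        by (intro frac_le power_mono) (auto intro!: mult_nonneg_nonneg divide_nonneg_nonneg)
      also have "\<dots> = norm u * norm v / (b - a) * (a / b) ^ m"
        by (simp add: power_divide)
      finally have rem: "cmod (cdot u (resolvent A z *v w) / z ^ m) \<le> norm u * norm v / (b - a) * (a / b) ^ m" .
      have "exp (z * t) * cdot u (resolvent A z *v v) - (\<Sum>k<m. c k * (exp (z * t) / z ^ Suc k))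
          = exp (z * t) * (cdot u (resolvent A z *v w) / z ^ m)"
        unfolding resolvent_expansion[OF det_ne_0_of_large[OF A(2) za] z0, of u v m]
        by (simp add: w_def c_def ring_distribs sum_distrib_left mult_ac)
      then show "cmod (exp (z * t) * cdot u (resolvent A z *v v) - (\<Sum>k<m. c k * (exp (z * t) / z ^ Suc k)))
          \<le> E * (norm u * norm v / (b - a) * (a / b) ^ m)"
        using E rem by (simp only: norm_mult) (intro mult_mono, auto simp: E_def)
    qed
    then show ?thesis by (simp only: mult_ac)
  qed
  have "(\<lambda>m. E * (norm u * norm v / (b - a)) * (2 * pi * R) * (a / b) ^ m)
      \<longlonglongrightarrow> E * (norm u * norm v / (b - a)) * (2 * pi * R) * 0"
  proof (rule tendsto_mult[OF tendsto_const])
    show "(\<lambda>m. (a / b) ^ m) \<longlonglongrightarrow> 0"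
      using A(1) b by (simp add: LIMSEQ_power_zero)
  qed
  then have "(\<lambda>m. E * (norm u * norm v / (b - a)) * (2 * pi * R) * (a / b) ^ m) \<longlonglongrightarrow> 0"
    by (simp only: mult_zero_right)
  then have "(\<lambda>m. I - S m) \<longlonglongrightarrow> 0"
    by (rule Lim_null_comparison[OF always_eventually, OF allI, OF bound])
  then have "S \<longlonglongrightarrow> I"
    using tendsto_diff[OF tendsto_const[of I] \<open>(\<lambda>m. I - S m) \<longlonglongrightarrow> 0\<close>] by simp
  moreover have "S \<longlonglongrightarrow> 2 * pi * \<i> * impulse A u v t"
  proof -
    have "S = (\<lambda>m. 2 * pi * \<i> * (\<Sum>k<m. cdot u (((*v) A ^^ k) v) / fact k * t ^ k))"
      by (simp add: fun_eq_iff S_def c_def sum_distrib_left mult_ac)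
    then show ?thesis
      using tendsto_mult_left[OF impulse_sums[of u A v t, unfolded sums_def], of "2 * pi * \<i>"]
      by simp
  qed
  ultimately show ?thesis using LIMSEQ_unique by blast
qed

subsection \<open>Laplace inversion\<close>

text \<open>Spijker's lemma on a segment. An affine parametrization keeps \<open>r\<close> a
  quotient of polynomials of degree at most \<open>n\<close>, so the polygon bound holds for the
  image curve and passes to its length.\<close>

lemma chord_derivative_integral_le:
  fixes P Q :: "complex poly"
  assumes deg: "degree P \<le> n" "degree Q \<le> n"
    and r: "\<And>z. poly P z \<noteq> 0 \<Longrightarrow> r z = poly Q z / poly P z"
    and der: "\<And>z. poly P z \<noteq> 0 \<Longrightarrow> (r has_field_derivative r' z) (at z)"
    and cont: "continuous_on (closed_segment a b) r'"
    and nz: "\<And>z. z \<in> closed_segment a b \<Longrightarrow> poly P z \<noteq> 0"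
    and bound: "\<And>z. z \<in> closed_segment a b \<Longrightarrow> cmod (r z) \<le> M"
  shows "integral {0..1} (\<lambda>x. cmod (r' (linepath a b x) * (b - a))) \<le> 2 * pi * n * M"
proof (rule integral_norm_derivative_le_polygons)
  define l where "l = [:a, b - a:]"
  have l: "poly l (of_real x) = linepath a b x" for x
    by (simp add: l_def linepath_def algebra_simps scaleR_conv_of_real)
  have seg: "linepath a b x \<in> closed_segment a b" if "x \<in> {0..1}" for x
    using that by (simp add: linepath_in_path)
  show "((\<lambda>x. r (linepath a b x)) has_vector_derivative r' (linepath a b x) * (b - a)) (at x within {0..1})"
    if "x \<in> {0..1}" for x
    using field_vector_diff_chain_within[OF has_vector_derivative_linepath_within[of a b x "{0..1}"]
        has_field_derivative_at_within[OF der[OF nz[OF seg[OF that]]]]]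
    by (simp add: o_def mult.commute)
  show "continuous_on {0..1} (\<lambda>x. r' (linepath a b x) * (b - a))"
    by (intro continuous_intros continuous_on_compose2[OF cont]) (auto simp: seg)
  show "(\<Sum>i<m. cmod (r (linepath a b (real (Suc i) / m)) - r (linepath a b (real i / m)))) \<le> 2 * pi * n * M"
    if m: "m > 0" for m
  proof -
    define t where "t i = real i / m" for i
    have t: "strict_mono t" using m by (auto simp: strict_mono_def t_def divide_strict_right_mono)
    have t01: "{t 0..t m} = {0..1}" using m by (simp add: t_def)
    have ti: "t i \<in> {0..1}" if "i \<le> m" for i using that m by (simp add: t_def field_simps)
    have quot: "poly (pcompose Q l) (of_real x) / poly (pcompose P l) (of_real x) = r (linepath a b x)"
      if "x \<in> {0..1}" for x
      using r[OF nz[OF seg[OF that]]] by (simp add: poly_pcompose l)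
    have degl: "degree (pcompose p l) \<le> degree p" for p
      using degree_pcompose_le[of p l] by (simp add: l_def split: if_splits)
    have "(\<Sum>i<m. cmod (poly (pcompose Q l) (of_real (t (Suc i))) / poly (pcompose P l) (of_real (t (Suc i)))
          - poly (pcompose Q l) (of_real (t i)) / poly (pcompose P l) (of_real (t i)))) \<le> 2 * pi * n * M"
    proof (rule Spijker_polygon[OF _ _ t])
      show "degree (pcompose P l) \<le> n" "degree (pcompose Q l) \<le> n"
        using deg degl order_trans by blast+
      show "poly (pcompose P l) (of_real x) \<noteq> 0" if "x \<in> {t 0..t m}" for x
        using nz[OF seg] that by (simp add: poly_pcompose l t01)
      show "cmod (poly (pcompose Q l) (of_real x) / poly (pcompose P l) (of_real x)) \<le> M"
        if "x \<in> {t 0..t m}" for x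
        using that bound[OF seg] by (simp only: t01 quot)
    qed
    also have "(\<Sum>i<m. cmod (poly (pcompose Q l) (of_real (t (Suc i))) / poly (pcompose P l) (of_real (t (Suc i)))
          - poly (pcompose Q l) (of_real (t i)) / poly (pcompose P l) (of_real (t i))))
        = (\<Sum>i<m. cmod (r (linepath a b (t (Suc i))) - r (linepath a b (t i))))"
    proof (rule sum.cong[OF refl])
      fix i assume "i \<in> {..<m}"
      then have "t i \<in> {0..1}" "t (Suc i) \<in> {0..1}" using ti[of i] ti[of "Suc i"] by auto
      then show "cmod (poly (pcompose Q l) (of_real (t (Suc i))) / poly (pcompose P l) (of_real (t (Suc i)))
          - poly (pcompose Q l) (of_real (t i)) / poly (pcompose P l) (of_real (t i)))
        = cmod (r (linepath a b (t (Suc i))) - r (linepath a b (t i)))"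
        by (simp only: quot)
    qed
    finally show ?thesis unfolding t_def .
  qed
qed

text \<open>On the convex set \<open>S\<close> the function has a primitive \<open>F\<close>, so the
  right half of the circle can be exchanged for the vertical diameter with the same end
  points.\<close>

lemma circle_integral_chord_split:
  fixes f :: "complex \<Rightarrow> complex"
  assumes S: "convex S" "open S" "f holomorphic_on S"
    and right: "\<And>z. \<sigma> \<le> Re z \<Longrightarrow> z \<in> S"
    and R: "R > 0"
    and cont: "continuous_on (sphere (of_real \<sigma>) R) f"
    and I: "(f has_contour_integral I) (circlepath (of_real \<sigma>) R)"
  obtains J K where
    "(f has_contour_integral J) (linepath (of_real \<sigma> - \<i> * R) (of_real \<sigma> + \<i> * R))"
    "(f has_contour_integral K) (part_circlepath (of_real \<sigma>) R (pi/2) (3*pi/2))"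
    "I = J + K"
proof -
  let ?c = "complex_of_real \<sigma>"
  let ?p = "\<lambda>a b. part_circlepath ?c R a b"
  obtain F where F: "\<And>x. x \<in> S \<Longrightarrow> (F has_field_derivative f x) (at x within S)"
    using holomorphic_convex_primitive'[OF S] by blast
  have arc: "(f has_contour_integral (F (?c + R * cis b) - F (?c + R * cis a))) (?p a b)"
    if "a \<le> b" "\<And>x. a \<le> x \<Longrightarrow> x \<le> b \<Longrightarrow> cos x \<ge> 0" for a b
  proof -
    have "path_image (?p a b) \<subseteq> S"
      using that R by (auto simp: path_image_part_circlepath' closed_segment_eq_real_ivl intro!: right)
    then show ?thesis
      using contour_integral_primitive[OF F valid_path_part_circlepath, of ?c R a b]
      by (simp add: cis_conv_exp)
  qed
  have line: "(f has_contour_integral (F (?c + \<i> * R) - F (?c - \<i> * R))) (linepath (?c - \<i> * R) (?c + \<i> * R))"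
  proof -
    have "closed_segment (?c - \<i> * R) (?c + \<i> * R) \<subseteq> S"
      using S(1) right by (intro closed_segment_subset) auto
    then show ?thesis
      using contour_integral_primitive[OF F valid_path_linepath, of "?c - \<i> * R" "?c + \<i> * R"] by simp
  qed
  have "f contour_integrable_on ?p (pi/2) (3*pi/2)"
    using R by (intro contour_integrable_continuous_part_circlepath continuous_on_subset[OF cont]
        path_image_part_circlepath_subset) auto
  then obtain K where K: "(f has_contour_integral K) (?p (pi/2) (3*pi/2))"
    by (auto simp: contour_integrable_on_def)
  \<comment> \<open>The arcs and the full circle share this integrand in the angle. The circle
    starts at angle 0, so its right half comes in two arcs, and the values of \<open>F\<close> at
    the angles 0 and \<open>2*pi\<close> cancel.\<close>
  define h where "h = (\<lambda>\<theta>. f (?c + R * cis \<theta>) * R * \<i> * cis \<theta>)"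
  have "(h has_integral (F (?c + R * cis (pi/2)) - F (?c + R * cis 0))) {0..pi/2}"
    using arc[of 0 "pi/2"] cos_ge_zero
    by (simp add: has_contour_integral_part_circlepath_iff h_def)
  moreover have "(h has_integral K) {pi/2..3*pi/2}"
    using K by (simp add: has_contour_integral_part_circlepath_iff h_def)
  moreover have "(h has_integral (F (?c + R * cis (2*pi)) - F (?c + R * cis (3*pi/2)))) {3*pi/2..2*pi}"
  proof -
    have "cos x \<ge> 0" if "3*pi/2 \<le> x" "x \<le> 2*pi" for x
      using cos_ge_zero[of "x - 2*pi"] that by (simp add: cos_diff)
    then show ?thesis
      using arc[of "3*pi/2" "2*pi"] by (simp add: has_contour_integral_part_circlepath_iff h_def)
  qed
  ultimately have total: "(h has_integral ((F (?c + R * cis (pi/2)) - F (?c + R * cis 0)) + K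
      + (F (?c + R * cis (2*pi)) - F (?c + R * cis (3*pi/2))))) {0..2*pi}"
    by (intro has_integral_combine[of 0 "3*pi/2" "2*pi"] has_integral_combine[of 0 "pi/2" "3*pi/2"]) auto
  have circle: "(h has_integral I) {0..2*pi}"
    using I by (simp add: circlepath_def has_contour_integral_part_circlepath_iff h_def)
  have "cis (3*pi/2) = - \<i>"
  proof -
    have "3*pi/2 = pi + pi/2" by simp
    then show ?thesis by (simp only: cis_mult[symmetric] cis_pi cis_pi_half mult_minus1)
  qed
  then have "I = (F (?c + \<i> * R) - F (?c - \<i> * R)) + K"
    using has_integral_unique[OF circle total] by (simp add: mult.commute[of _ \<i>])
  with that line K show thesis by blast
qed

text \<open>Inversion on a large circle about \<open>\<sigma>\<close>, integrated by parts. The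
  right half is deformed to the vertical diameter, where Spijker's lemma gives a bound independent
  of the radius; on the left half the derivative is of order \<open>1 / R\<^sup>2\<close>, so that
  arc disappears in the limit.\<close>

lemma impulse_bound:
  fixes A :: "complex^'n^'n" and M :: real
  assumes det: "\<And>z. Re z > 0 \<Longrightarrow> det (mat z - A) \<noteq> 0"
    and \<sigma>: "\<sigma> > 0" and t: "t > 0"
    and M: "\<And>z. Re z = \<sigma> \<Longrightarrow> cmod (cdot u (resolvent A z *v v)) \<le> M"
  shows "cmod (impulse A u v (of_real t)) \<le> CARD('n) * M * exp (\<sigma> * t) / t"
proof -
  obtain P Q where deg: "degree P \<le> CARD('n)" "degree Q \<le> CARD('n)"
    and P: "\<And>z. poly P z = det (mat z - A)"
    and Q: "\<And>z. poly P z \<noteq> 0 \<Longrightarrow> cdot u (resolvent A z *v v) = poly Q z / poly P z"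
    using resolvent_rational by metis
  obtain a where a: "a > 0" "\<And>x. norm (A *v x) \<le> a * norm x" using matrix_bound by blast
  define r where "r z = cdot u (resolvent A z *v v)" for z
  define D where "D = {z. poly P z \<noteq> 0}"
  define f where "f z = exp (z * of_real t) * deriv r z" for z
  have D: "open D" unfolding D_def by (intro open_Collect_neq continuous_intros)
  have "(\<lambda>z. poly Q z / poly P z) holomorphic_on D"
    unfolding D_def by (intro holomorphic_intros) auto
  then have holr: "r holomorphic_on D"
    by (rule holomorphic_transform) (simp add: D_def r_def Q)
  have der: "(r has_field_derivative deriv r z) (at z)" if "z \<in> D" for z
    using holomorphic_derivI[OF holr D that] .
  have hol': "deriv r holomorphic_on D" using holomorphic_deriv[OF holr D] .
  have holf: "f holomorphic_on D" unfolding f_def by (intro holomorphic_intros hol')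
  have rightD: "z \<in> D" if "Re z > 0" for z using det[OF that] by (simp add: D_def P)
  have farD: "z \<in> D" if "cmod z > a" for z
    using det_ne_0_of_large[OF a(2) that] by (simp add: D_def P)
  have r_le: "cmod (r z) \<le> norm u * norm v / b" if "cmod z \<ge> a + b" "b > 0" for z b
  proof -
    have "cmod (r z) \<le> norm u * (norm v / (cmod z - a))"
      unfolding r_def using cmod_cdot_le[of u "resolvent A z *v v"] norm_resolvent_le[OF a(2), of z v] that
      by (smt (verit) mult_left_mono norm_ge_zero)
    also have "\<dots> \<le> norm u * (norm v / b)"
      using that by (intro mult_left_mono frac_le) auto
    finally show ?thesis by simp
  qed
  \<comment> \<open>The threshold on \<open>R\<close> is what makes
    \<open>cmod w \<ge> a + R / 3\<close> hold on the disc of radius \<open>R / 3\<close> about any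
    point of the circle.\<close>
  have estimate: "2 * pi * t * cmod (impulse A u v (of_real t))
      \<le> exp (\<sigma> * t) * (2 * pi * CARD('n) * M + 9 * norm u * norm v * pi / R)"
    if R: "R \<ge> 3 * (\<sigma> + a)" for R
  proof -
    let ?c = "complex_of_real \<sigma>"
    have "0 < 3 * (\<sigma> + a)" using \<sigma> a(1) by simp
    then have R0: "R > 0" using R by (rule less_le_trans)
    have far: "cmod z \<ge> R - \<sigma>" if "z \<in> sphere ?c R" for z
      using norm_triangle_ineq2[of "z - ?c" "- ?c"] that \<sigma> by (simp add: dist_norm norm_minus_commute)
    have circD: "sphere ?c R \<subseteq> D"
      using far farD R a(1) \<sigma> by fastforce
    have contr: "continuous_on (path_image (circlepath ?c R)) (\<lambda>z. exp (z * of_real t) * r z)"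
      using R0 circD holomorphic_on_imp_continuous_on[OF holr]
      by (intro continuous_intros) (auto intro: continuous_on_subset)
    then obtain I0 where I0: "((\<lambda>z. exp (z * of_real t) * r z) has_contour_integral I0) (circlepath ?c R)"
      using contour_integrable_continuous_circlepath unfolding contour_integrable_on_def by blast
    have I0_eq: "I0 = 2 * pi * \<i> * impulse A u v (of_real t)"
      using I0 R \<sigma> a(1) unfolding r_def by (intro impulse_circle_integral[OF a]) auto
    \<comment> \<open>Integration by parts: the integrand is the derivative of
      \<open>exp (z * of_real t) * r z\<close>, and the circle is closed.\<close>
    have "((\<lambda>z. of_real t * (exp (z * of_real t) * r z) + f z) has_contour_integral 0) (circlepath ?c R)"
    proof (rule Cauchy_theorem_primitive)
      fix z assume "z \<in> D"
      then show "((\<lambda>z. exp (z * of_real t) * r z) has_field_derivative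
          of_real t * (exp (z * of_real t) * r z) + f z) (at z within D)"
        unfolding f_def
        by (auto intro!: derivative_eq_intros has_field_derivative_at_within[OF der])
    qed (use R0 circD in auto)
    from has_contour_integral_diff[OF this has_contour_integral_lmul[OF I0, of "of_real t"]]
    have If: "(f has_contour_integral (- of_real t * I0)) (circlepath ?c R)" by simp
    have holf': "f holomorphic_on {z. Re z > 0}"
      by (rule holomorphic_on_subset[OF holf]) (auto intro: rightD)
    obtain J K where J: "(f has_contour_integral J) (linepath (?c - \<i> * R) (?c + \<i> * R))"
      and K: "(f has_contour_integral K) (part_circlepath ?c R (pi/2) (3*pi/2))"
      and JK: "- of_real t * I0 = J + K"
      using circle_integral_chord_split[OF convex_halfspace_Re_gt open_halfspace_Re_gt holf' _ R0
          continuous_on_subset[OF holomorphic_on_imp_continuous_on[OF holf] circD] If] \<sigma>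
      by auto
    have K_le: "cmod K \<le> exp (\<sigma> * t) * (9 * norm u * norm v / R\<^sup>2) * R * (3*pi/2 - pi/2)"
    proof (rule has_contour_integral_bound_part_circlepath[OF K _ R0])
      fix z assume "z \<in> path_image (part_circlepath ?c R (pi/2) (3*pi/2))"
      then obtain x where x: "pi/2 \<le> x" "x \<le> 3*pi/2" and z: "z = ?c + R * cis x"
        by (auto simp: path_image_part_circlepath' closed_segment_eq_real_ivl)
      have "z \<in> sphere ?c R" using R0 by (simp add: z dist_norm norm_mult)
      note zfar = far[OF this]
      \<comment> \<open>On the left half the cosine of the angle is at most 0, so the exponential is
        no larger than on the diameter.\<close>
      have "cos (x - pi) \<ge> 0" using x by (intro cos_ge_zero) auto
      then have "Re z \<le> \<sigma>" using R0 by (simp add: z mult_nonneg_nonpos)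
      then have e: "cmod (exp (z * of_real t)) \<le> exp (\<sigma> * t)"
        using t by (simp add: norm_exp_eq_Re)
      have near: "cmod w \<ge> a + R / 3" if "w \<in> cball z (R / 3)" for w
        using norm_triangle_ineq2[of z w] that zfar R by (simp add: dist_norm)
      then have "cball z (R / 3) \<subseteq> D" using farD R0 by fastforce
      \<comment> \<open>Cauchy's inequality on the disc of radius \<open>R / 3\<close>, where
        \<open>r\<close> is at most \<open>3 * norm u * norm v / R\<close>; hence the factor
        9.\<close>
      then have "cmod ((deriv ^^ 1) r z) \<le> fact 1 * (norm u * norm v / (R / 3)) / (R / 3) ^ 1"
        using R0 near
        by (intro Cauchy_inequality holomorphic_on_subset[OF holr]
            continuous_on_subset[OF holomorphic_on_imp_continuous_on[OF holr]] r_le)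
          (auto simp: dist_norm ball_subset_cball[THEN subsetD] subset_iff)
      then have "cmod (deriv r z) \<le> 9 * norm u * norm v / R\<^sup>2"
        by (simp add: power2_eq_square field_simps)
      then show "cmod (f z) \<le> exp (\<sigma> * t) * (9 * norm u * norm v / R\<^sup>2)"
        unfolding f_def norm_mult using e by (intro mult_mono) auto
    qed auto
    \<comment> \<open>On the diameter the exponential has constant modulus; what remains is the
      length of the curve traced by \<open>r\<close>.\<close>
    have J_le: "cmod J \<le> exp (\<sigma> * t) * (2 * pi * CARD('n) * M)"
    proof -
      let ?l = "linepath (?c - \<i> * R) (?c + \<i> * R)"
      let ?d = "(?c + \<i> * R) - (?c - \<i> * R)"
      have Re_l: "Re (?l x) = \<sigma>" for x by (simp add: linepath_def algebra_simps)
      then have Re_seg: "Re z = \<sigma>" if "z \<in> closed_segment (?c - \<i> * R) (?c + \<i> * R)" for z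
        using that by (auto simp: linepath_image_01[symmetric])
      have segD: "closed_segment (?c - \<i> * R) (?c + \<i> * R) \<subseteq> D"
        using Re_seg rightD \<sigma> by auto
      have cont': "continuous_on (closed_segment (?c - \<i> * R) (?c + \<i> * R)) (deriv r)"
        using holomorphic_on_imp_continuous_on[OF hol'] segD continuous_on_subset by blast
      have "continuous_on {0..1} (\<lambda>x. deriv r (?l x) * ?d)"
        by (intro continuous_intros continuous_on_compose2[OF cont']) (auto simp: linepath_in_path)
      then have int: "(\<lambda>x. cmod (deriv r (?l x) * ?d)) integrable_on {0..1}"
        by (intro integrable_continuous_real continuous_on_norm)
      have Jint: "((\<lambda>x. f (?l x) * ?d) has_integral J) {0..1}"
        using J unfolding has_contour_integral_linepath .
      have "cmod (integral {0..1} (\<lambda>x. f (?l x) * ?d))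
          \<le> integral {0..1} (\<lambda>x. exp (\<sigma> * t) * cmod (deriv r (?l x) * ?d))"
      proof (rule integral_norm_bound_integral)
        show "(\<lambda>x. f (?l x) * ?d) integrable_on {0..1}" using Jint by blast
        show "(\<lambda>x. exp (\<sigma> * t) * cmod (deriv r (?l x) * ?d)) integrable_on {0..1}"
          using integrable_on_cmult_left[OF int] by simp
        show "cmod (f (?l x) * ?d) \<le> exp (\<sigma> * t) * cmod (deriv r (?l x) * ?d)" for x
          by (simp add: f_def norm_mult norm_exp_eq_Re Re_l)
      qed
      then have "cmod J \<le> exp (\<sigma> * t) * integral {0..1} (\<lambda>x. cmod (deriv r (?l x) * ?d))"
        using integral_unique[OF Jint] by simp
      also have "\<dots> \<le> exp (\<sigma> * t) * (2 * pi * CARD('n) * M)"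
      proof (intro mult_left_mono chord_derivative_integral_le[OF deg])
        show "r z = poly Q z / poly P z" if "poly P z \<noteq> 0" for z
          using Q[OF that] by (simp add: r_def)
        show "(r has_field_derivative deriv r z) (at z)" if "poly P z \<noteq> 0" for z
          using der that by (simp add: D_def)
        show "poly P z \<noteq> 0" if "z \<in> closed_segment (?c - \<i> * R) (?c + \<i> * R)" for z
          using that segD by (auto simp: D_def)
        show "cmod (r z) \<le> M" if "z \<in> closed_segment (?c - \<i> * R) (?c + \<i> * R)" for z
          using M[OF Re_seg[OF that]] by (simp add: r_def)
      qed (auto simp: cont')
      finally show ?thesis .
    qed
    have "2 * pi * t * cmod (impulse A u v (of_real t)) = cmod (- of_real t * I0)"
      using t by (simp add: I0_eq norm_mult)
    also have "\<dots> \<le> cmod J + cmod K" unfolding JK by (rule norm_triangle_ineq)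
    also have "\<dots> \<le> exp (\<sigma> * t) * (2 * pi * CARD('n) * M)
        + exp (\<sigma> * t) * (9 * norm u * norm v / R\<^sup>2) * R * (3*pi/2 - pi/2)"
      using J_le K_le by (rule add_mono)
    also have "\<dots> = exp (\<sigma> * t) * (2 * pi * CARD('n) * M + 9 * norm u * norm v * pi / R)"
      using R0 by (simp add: field_simps power2_eq_square)
    finally show ?thesis .
  qed
  have lim: "((\<lambda>R. exp (\<sigma> * t) * (2 * pi * CARD('n) * M + 9 * norm u * norm v * pi / R))
      \<longlongrightarrow> exp (\<sigma> * t) * (2 * pi * CARD('n) * M + 0)) at_top"
    by (intro tendsto_mult tendsto_add tendsto_const real_tendsto_divide_at_top[OF tendsto_const] filterlim_ident)
  have "2 * pi * t * cmod (impulse A u v (of_real t)) \<le> exp (\<sigma> * t) * (2 * pi * CARD('n) * M + 0)"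
  proof (rule tendsto_lowerbound[OF lim])
    show "\<forall>\<^sub>F R in at_top. 2 * pi * t * cmod (impulse A u v (of_real t))
        \<le> exp (\<sigma> * t) * (2 * pi * CARD('n) * M + 9 * norm u * norm v * pi / R)"
      using eventually_ge_at_top[of "3 * (\<sigma> + a)"] by eventually_elim (rule estimate)
  qed (rule trivial_limit_at_top_linorder)
  then show ?thesis using t by (simp add: field_simps)
qed

subsection \<open>Both inequalities\<close>

text \<open>Compactness handles the part of the line with \<open>cmod z \<le> a + 1\<close>; beyond
  it \<open>cmod z - a\<close> exceeds 1. This supplies a finite constant for
  \<open>impulse_bound\<close> when no Kreiss bound is at hand.\<close>

lemma resolvent_bounded_on_line:
  fixes A :: "complex^'n^'n"
  assumes det: "\<And>z. Re z = \<sigma> \<Longrightarrow> det (mat z - A) \<noteq> 0"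
  obtains M where "\<And>z. Re z = \<sigma> \<Longrightarrow> cmod (cdot u (resolvent A z *v v)) \<le> M"
proof -
  obtain P Q where P: "\<And>z. poly P z = det (mat z - A)"
    and Q: "\<And>z. poly P z \<noteq> 0 \<Longrightarrow> cdot u (resolvent A z *v v) = poly Q z / poly P z"
    using resolvent_rational by metis
  obtain a where a: "a > 0" "\<And>x. norm (A *v x) \<le> a * norm x" using matrix_bound by blast
  define L where "L = {z. Re z = \<sigma>} \<inter> cball 0 (a + 1)"
  have "compact L" unfolding L_def
    by (intro closed_Int_compact compact_cball closed_Collect_eq continuous_intros)
  moreover have "continuous_on L (\<lambda>z. poly Q z / poly P z)"
    using det by (intro continuous_intros) (auto simp: L_def P)
  ultimately have "bounded ((\<lambda>z. poly Q z / poly P z) ` L)"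
    by (intro compact_imp_bounded compact_continuous_image)
  then obtain b where b: "\<And>z. z \<in> L \<Longrightarrow> cmod (poly Q z / poly P z) \<le> b"
    unfolding bounded_iff by blast
  have "cmod (cdot u (resolvent A z *v v)) \<le> max b (norm u * norm v)" if z: "Re z = \<sigma>" for z
  proof (cases "cmod z \<le> a + 1")
    case True
    then have "cmod (poly Q z / poly P z) \<le> b" using z by (intro b) (simp add: L_def)
    then show ?thesis using Q det[OF z] by (simp add: P)
  next
    case False
    then have "norm (resolvent A z *v v) \<le> norm v / (cmod z - a)"
      by (intro norm_resolvent_le a(2)) simp
    also have "\<dots> \<le> norm v / 1" using False by (intro divide_left_mono) auto
    finally have "norm u * norm (resolvent A z *v v) \<le> norm u * norm v"
      by (intro mult_left_mono) auto
    then show ?thesis using cmod_cdot_le[of u "resolvent A z *v v"] by linarith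
  qed
  with that show thesis by blast
qed

section \<open>Calculus of the impulse series\<close>

lemma funpow_matrix_linear:
  fixes A :: "complex^'n^'n"
  shows funpow_matrix_diff: "((*v) A ^^ k) (x - y) = ((*v) A ^^ k) x - ((*v) A ^^ k) y"
    and funpow_matrix_scale: "((*v) A ^^ k) (c *s x) = c *s (((*v) A ^^ k) x)"
  by (induction k) (simp_all add: matrix_vector_mult_diff_distrib vec.scale)

lemma impulse_linear:
  shows impulse_diff: "impulse A u (x - y) t = impulse A u x t - impulse A u y t"
    and impulse_scale: "impulse A u (c *s x) t = c * impulse A u x t"
proof -
  show "impulse A u (x - y) t = impulse A u x t - impulse A u y t"
    using sums_diff[OF impulse_sums[of u A x t] impulse_sums[of u A y t]] impulse_sums[of u A "x - y" t]
    by (intro sums_unique2) (simp_all add: funpow_matrix_diff cdot_diff diff_divide_distrib left_diff_distrib)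
  show "impulse A u (c *s x) t = c * impulse A u x t"
    using sums_mult[OF impulse_sums[of u A x t], of c] impulse_sums[of u A "c *s x" t]
    by (intro sums_unique2) (simp_all add: funpow_matrix_scale cdot_scale mult.assoc)
qed

lemma impulse_0: "impulse A u v 0 = cdot u v"
  unfolding impulse_def powser_zero by simp

text \<open>Differentiating term by term shifts the coefficients, which moves one factor
  \<open>A\<close> onto \<open>v\<close>.\<close>

lemma impulse_has_field_derivative:
  fixes A :: "complex^'n^'n"
  shows "(impulse A u v has_field_derivative impulse A u (A *v v) t) (at t)"
proof -
  define c where "c k = cdot u (((*v) A ^^ k) v) / fact k" for k
  have "diffs c k = cdot u (((*v) A ^^ k) (A *v v)) / fact k" for k
    by (simp add: diffs_def c_def funpow_swap1 divide_simps del: of_nat_Suc)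
  moreover have "summable (\<lambda>k. c k * y ^ k)" for y
    using impulse_sums[of u A v y] by (simp add: c_def sums_iff)
  ultimately show ?thesis
    using termdiffs_strong_converges_everywhere[of c t] by (simp add: impulse_def[abs_def] c_def)
qed

text \<open>The norm on matrices is Euclidean in the entries and not an operator norm, so powers are
  bounded through their action on basis vectors; the factor counts the entries.\<close>

lemma norm_mat_power_le:
  fixes M :: "real^'n^'n"
  obtains a where "a > 0" "\<And>k. norm (mat_power M k) \<le> (real CARD('n))\<^sup>2 * a ^ k"
proof -
  obtain a where a: "a > 0" "\<And>x. norm (M *v x) \<le> norm x * a"
    using bounded_linear.pos_bounded[OF matrix_vector_mul_bounded_linear, of M] by auto
  have col: "norm (mat_power M k *v x) \<le> a ^ k * norm x" for k x
  proof (induction k)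
    case (Suc k)
    have "norm (mat_power M (Suc k) *v x) = norm (M *v (mat_power M k *v x))"
      by (simp add: matrix_vector_mul_assoc)
    also have "\<dots> \<le> norm (mat_power M k *v x) * a" by (rule a(2))
    also have "\<dots> \<le> (a ^ k * norm x) * a" using Suc a(1) by (intro mult_right_mono) auto
    finally show ?case by (simp add: mult_ac)
  qed simp
  have entry: "norm (mat_power M k $ i $ j) \<le> a ^ k" for k i j
  proof -
    have "norm (mat_power M k $ i $ j) = norm ((mat_power M k *v axis j 1) $ i)"
      by (simp add: matrix_vector_mult_basis column_def)
    also have "\<dots> \<le> norm (mat_power M k *v axis j 1)" by (rule Finite_Cartesian_Product.norm_nth_le)
    also have "\<dots> \<le> a ^ k" using col[of k "axis j 1"] by (simp add: norm_axis_1)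
    finally show ?thesis .
  qed
  have "norm (mat_power M k) \<le> (real CARD('n))\<^sup>2 * a ^ k" for k
  proof -
    have "norm (mat_power M k) \<le> (\<Sum>i\<in>UNIV. norm (mat_power M k $ i))"
      unfolding norm_vec_def[of "mat_power M k"] by (intro L2_set_le_sum) auto
    also have "\<dots> \<le> (\<Sum>i\<in>UNIV. \<Sum>j\<in>UNIV. norm (mat_power M k $ i $ j))"
      unfolding norm_vec_def[of "mat_power M k $ i" for i] by (intro sum_mono L2_set_le_sum) auto
    also have "\<dots> \<le> (\<Sum>i\<in>(UNIV :: 'n set). \<Sum>j\<in>(UNIV :: 'n set). a ^ k)"
      by (intro sum_mono entry)
    also have "\<dots> = (real CARD('n))\<^sup>2 * a ^ k" by (simp add: power2_eq_square)
    finally show ?thesis .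
  qed
  with a(1) that show thesis by blast
qed

lemma mat_exp_summable: "summable (\<lambda>k. mat_power (M :: real^'n^'n) k /\<^sub>R fact k)"
proof -
  obtain a where a: "a > 0" "\<And>k. norm (mat_power M k) \<le> (real CARD('n))\<^sup>2 * a ^ k"
    using norm_mat_power_le by blast
  have "norm (mat_power M k /\<^sub>R fact k) \<le> (real CARD('n))\<^sup>2 * (a ^ k /\<^sub>R fact k)" for k
    using mult_left_mono[OF a(2)[of k], of "inverse (fact k)"] by (simp add: mult_ac)
  moreover have "summable (\<lambda>k. (real CARD('n))\<^sup>2 * (a ^ k /\<^sub>R fact k))"
    by (rule summable_mult[OF summable_exp_generic])
  ultimately show ?thesis by (rule summable_comparison_test'[rotated])
qed

lemma complex_matrix_mult: "complex_matrix (X ** Y) = complex_matrix X ** complex_matrix Y"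
  by (simp add: vec_eq_iff matrix_matrix_mult_def)

lemma complex_matrix_scaleR_mult:
  "complex_matrix (a *\<^sub>R X) *v x = of_real a *s (complex_matrix X *v x)"
  by (simp add: vec_eq_iff matrix_vector_mult_def sum_distrib_left mult_ac)

lemma complex_matrix_add: "complex_matrix (X + Y) = complex_matrix X + complex_matrix Y"
  by (simp add: vec_eq_iff)

lemma complex_matrix_power:
  fixes A :: "real^'n^'n"
  shows "complex_matrix (mat_power (t *\<^sub>R A) k) *v x = of_real t ^ k *s (((*v) (complex_matrix A) ^^ k) x)"
proof (induction k)
  case 0
  have "complex_matrix (mat 1 :: real^'n^'n) = mat 1" by (simp add: vec_eq_iff mat_def)
  then show ?case by simp
next
  case (Suc k)
  then show ?case
    by (simp add: complex_matrix_mult matrix_vector_mul_assoc[symmetric] complex_matrix_scaleR_mult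
        vec.scale)
qed

text \<open>Pairing with fixed vectors is a bounded linear functional of the real matrix, so it
  passes through the exponential series.\<close>

lemma cdot_mat_exp:
  fixes A :: "real^'n^'n"
  shows "cdot u (complex_matrix (mat_exp (t *\<^sub>R A)) *v x) = impulse (complex_matrix A) u x (of_real t)"
proof -
  define T where "T X = cdot u (complex_matrix X *v x)" for X :: "real^'n^'n"
  have "linear T"
    by (rule linearI)
      (simp_all add: T_def complex_matrix_add matrix_vector_mult_add_rdistrib cdot_add
        complex_matrix_scaleR_mult cdot_scale scaleR_conv_of_real[where 'a = complex])
  then have T: "bounded_linear T" by (simp add: linear_conv_bounded_linear)
  have "T (mat_power (t *\<^sub>R A) k /\<^sub>R fact k)
      = cdot u (((*v) (complex_matrix A) ^^ k) x) / fact k * of_real t ^ k" for k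
    by (simp add: T_def complex_matrix_scaleR_mult complex_matrix_power cdot_scale field_simps)
  then show ?thesis
    using bounded_linear.suminf[OF T mat_exp_summable[of "t *\<^sub>R A"]]
    by (simp add: T_def[symmetric] mat_exp_def impulse_def)
qed

text \<open>Moves \<open>C\<close> and \<open>B\<close> onto the two vectors, so that a scalar
  function of \<open>A\<close> alone remains; \<open>cdot_transfer_function\<close> does the same
  for the resolvent.\<close>

lemma cdot_response:
  "cdot u (complex_matrix (C ** mat_exp (t *\<^sub>R A) ** B) *v v)
    = impulse (complex_matrix A) (transpose (complex_matrix C) *v u) (complex_matrix B *v v) (of_real t)"
  by (simp add: complex_matrix_mult matrix_vector_mul_assoc[symmetric] cdot_matrix[of u "complex_matrix C"]
      cdot_mat_exp)

lemma cdot_transfer_function: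
  "cdot u (transfer_function A B C s *v v)
    = cdot (transpose (complex_matrix C) *v u) (resolvent (complex_matrix A) s *v (complex_matrix B *v v))"
  by (simp add: transfer_function_def resolvent_def matrix_vector_mul_assoc[symmetric]
      cdot_matrix[of u "complex_matrix C"])

lemma stable_det:
  assumes "stable A" "Re z > 0"
  shows "det (mat z - complex_matrix A) \<noteq> 0"
  using assms singular_imp_mat_eigenvalue unfolding stable_def by fastforce

lemma cmod_cdot_le_max_singular_value:
  assumes "norm u \<le> 1" "norm v = 1"
  shows "cmod (cdot u (M *v v)) \<le> max_singular_value M"
proof -
  have "cmod (cdot u (M *v v)) \<le> norm u * norm (M *v v)" by (rule cmod_cdot_le)
  also have "\<dots> \<le> 1 * max_singular_value M"
    using assms norm_mult_le_max_singular_value[of M v] by (intro mult_mono) auto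
  finally show ?thesis by simp
qed

text \<open>A functional norming the image of a maximising vector turns bilinear bounds into a
  matrix bound, so the analysis can be done on scalar functions.\<close>

lemma max_singular_value_leI:
  assumes "\<And>u v. norm u \<le> 1 \<Longrightarrow> norm v = 1 \<Longrightarrow> cmod (cdot u (M *v v)) \<le> b"
  shows "max_singular_value M \<le> b"
proof -
  obtain v where v: "norm v = 1" "norm (M *v v) = max_singular_value M"
    using max_singular_value_attained by metis
  obtain u where "norm u \<le> 1" "cdot u (M *v v) = of_real (norm (M *v v))"
    using norming_functional by metis
  with assms[of u v] v max_singular_value_nonneg[of M] show ?thesis by simp
qed

lemma peak_le_kreiss:
  fixes A :: "real^'n^'n" and B :: "real^'m^'n" and C :: "real^'n^'p"
  assumes A: "stable A" and t: "t \<ge> 0"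
    and k: "\<And>s. Re s > 0 \<Longrightarrow> Re s * max_singular_value (transfer_function A B C s) \<le> k"
  shows "max_singular_value (complex_matrix (C ** mat_exp (t *\<^sub>R A) ** B)) \<le> exp 1 * CARD('n) * k"
proof (rule max_singular_value_leI)
  fix u :: "complex^'p" and v :: "complex^'m"
  assume uv: "norm u \<le> 1" "norm v = 1"
  define g where "g = impulse (complex_matrix A) (transpose (complex_matrix C) *v u) (complex_matrix B *v v)"
  have pos: "cmod (g (of_real \<tau>)) \<le> exp 1 * CARD('n) * k" if \<tau>: "\<tau> > 0" for \<tau>
  proof -
    \<comment> \<open>The line of real part \<open>\<sigma>\<close> gives a bound proportional to
      \<open>exp (\<sigma> * \<tau>) / (\<sigma> * \<tau>)\<close>, which is smallest at
      \<open>\<sigma> = 1 / \<tau>\<close>.\<close>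
    have "cmod (g (of_real \<tau>)) \<le> CARD('n) * (k * \<tau>) * exp (1 / \<tau> * \<tau>) / \<tau>"
      unfolding g_def
    proof (rule impulse_bound)
      fix z assume z: "Re z = 1 / \<tau>"
      have "cmod (cdot u (transfer_function A B C z *v v)) \<le> max_singular_value (transfer_function A B C z)"
        using uv by (rule cmod_cdot_le_max_singular_value)
      also have "\<dots> \<le> k * \<tau>" using k[of z] \<tau> by (simp add: z field_simps)
      finally show "cmod (cdot (transpose (complex_matrix C) *v u)
          (resolvent (complex_matrix A) z *v (complex_matrix B *v v))) \<le> k * \<tau>"
        by (simp add: cdot_transfer_function)
    qed (use \<tau> stable_det[OF A] in auto)
    then show ?thesis using \<tau> by (simp add: mult_ac)
  qed
  have "cmod (g (of_real t)) \<le> exp 1 * CARD('n) * k"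
  proof (rule tendsto_upperbound)
    have "isCont g (of_real t)" unfolding g_def by (rule DERIV_isCont[OF impulse_has_field_derivative])
    then have "isCont (\<lambda>\<tau>. cmod (g (of_real \<tau>))) t"
      by (rule continuous_norm[OF isCont_o2[OF isCont_of_real[OF continuous_ident]]])
    then show "((\<lambda>\<tau>. cmod (g (of_real \<tau>))) \<longlongrightarrow> cmod (g (of_real t))) (at_right t)"
      by (simp add: isCont_def filterlim_at_split)
    show "\<forall>\<^sub>F \<tau> in at_right t. cmod (g (of_real \<tau>)) \<le> exp 1 * CARD('n) * k"
      using eventually_at_right_less[of t] by eventually_elim (use pos t in auto)
  qed simp
  then show "cmod (cdot u (complex_matrix (C ** mat_exp (t *\<^sub>R A) ** B) *v v)) \<le> exp 1 * CARD('n) * k"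
    by (simp add: cdot_response g_def)
qed

text \<open>Integrating the derivative \<open>- e\<^bsup>-st\<^esup> C e\<^bsup>tA\<^esup> B\<close> of
  \<open>e\<^bsup>-st\<^esup> C e\<^bsup>tA\<^esup> (sI - A)\<^bsup>-1\<^esup> B\<close> over \<open>[0, \<infinity>)\<close> replaces the Laplace transform.
  Stability enters through the exponential bound, applied on the line \<open>Re z = Re s / 2\<close>: it makes this
  expression vanish at infinity.\<close>

lemma kreiss_le_peak:
  fixes A :: "real^'n^'n" and B :: "real^'m^'n" and C :: "real^'n^'p"
  assumes A: "stable A" and s: "Re s > 0"
    and m: "\<And>t. t \<ge> 0 \<Longrightarrow> max_singular_value (complex_matrix (C ** mat_exp (t *\<^sub>R A) ** B)) \<le> m"
  shows "Re s * max_singular_value (transfer_function A B C s) \<le> m"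
proof -
  have "max_singular_value (transfer_function A B C s) \<le> m / Re s"
  proof (rule max_singular_value_leI)
    fix u :: "complex^'p" and v :: "complex^'m"
    assume uv: "norm u \<le> 1" "norm v = 1"
    let ?A = "complex_matrix A"
    define u' where "u' = transpose (complex_matrix C) *v u"
    define v' where "v' = complex_matrix B *v v"
    define w where "w = resolvent ?A s *v v'"
    \<comment> \<open>With this identity the derivative of \<open>g\<close> involves only the
      response to \<open>v'\<close>.\<close>
    have w: "v' = s *s w - ?A *v w"
      using resolvent_right[OF stable_det[OF A s], of v'] by (simp only: w_def mat_minus_mult)
    define g where "g \<tau> = exp (- s * of_real \<tau>) * impulse ?A u' w (of_real \<tau>)" for \<tau> :: real
    have der: "(g has_vector_derivative - exp (- s * of_real \<tau>) * impulse ?A u' v' (of_real \<tau>)) (at \<tau>)"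
      for \<tau>
    proof -
      have "((\<lambda>z. exp (- s * z) * impulse ?A u' w z) has_field_derivative
          - exp (- s * of_real \<tau>) * impulse ?A u' v' (of_real \<tau>)) (at (of_real \<tau>))"
        by (auto intro!: derivative_eq_intros impulse_has_field_derivative
            simp: w impulse_diff impulse_scale algebra_simps)
      then show ?thesis
        using has_vector_derivative_real_field by (auto simp: g_def[abs_def])
    qed
    have der_le: "cmod (- exp (- s * of_real \<tau>) * impulse ?A u' v' (of_real \<tau>)) \<le> m * exp (- Re s * \<tau>)"
      if "\<tau> > 0" for \<tau>
    proof -
      have "cmod (impulse ?A u' v' (of_real \<tau>)) \<le> m"
        using cmod_cdot_le_max_singular_value[OF uv] m[of \<tau>] that
        unfolding u'_def v'_def cdot_response[symmetric] by (meson less_imp_le order_trans)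
      then have "exp (- Re s * \<tau>) * cmod (impulse ?A u' v' (of_real \<tau>)) \<le> exp (- Re s * \<tau>) * m"
        by (rule mult_left_mono) simp
      then show ?thesis by (simp add: norm_mult norm_exp_eq_Re mult.commute)
    qed
    have m0: "m \<ge> 0" using order_trans[OF max_singular_value_nonneg m[of 0]] by simp
    obtain M where M: "\<And>z. Re z = Re s / 2 \<Longrightarrow> cmod (cdot u' (resolvent ?A z *v w)) \<le> M"
      using resolvent_bounded_on_line[of "Re s / 2" ?A u' w] stable_det[OF A] s by auto
    have M0: "M \<ge> 0" using order_trans[OF norm_ge_zero M[of "of_real (Re s / 2)"]] by simp
    have estimate: "cmod (g 0) \<le> m / Re s + CARD('n) * M / T" if T: "T > 0" for T
    proof -
      \<comment> \<open>The mean value inequality replaces an integral: the majorant is an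
        antiderivative of \<open>m * exp (- Re s * x)\<close>, and its total increase over all
        positive times is \<open>m / Re s\<close>.\<close>
      have "norm (g T - g 0) \<le> - m / Re s * exp (- Re s * T) - (- m / Re s * exp (- Re s * 0))"
      proof (rule differentiable_bound_general[OF T])
        show "continuous_on {0..T} g"
          using der has_vector_derivative_continuous continuous_at_imp_continuous_on by blast
        show "((\<lambda>x. - m / Re s * exp (- Re s * x)) has_vector_derivative m * exp (- Re s * x)) (at x)" for x
          using s unfolding has_real_derivative_iff_has_vector_derivative[symmetric]
          by (auto intro!: derivative_eq_intros)
        show "continuous_on {0..T} (\<lambda>x. - m / Re s * exp (- Re s * x))"
          by (intro continuous_intros) (use s in auto)
      qed (rule der der_le, assumption?)+
      also have "\<dots> \<le> m / Re s" using m0 s by simp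
      finally have 1: "cmod (g T - g 0) \<le> m / Re s" .
      have "cmod (impulse ?A u' w (of_real T)) \<le> CARD('n) * M * exp (Re s / 2 * T) / T"
        using s T M stable_det[OF A] by (intro impulse_bound) auto
      then have "exp (- Re s * T) * cmod (impulse ?A u' w (of_real T))
          \<le> exp (- Re s * T) * (CARD('n) * M * exp (Re s / 2 * T) / T)"
        by (rule mult_left_mono) simp
      also have "\<dots> = CARD('n) * M * exp (- Re s * T + Re s / 2 * T) / T"
        by (simp only: exp_add) simp
      \<comment> \<open>The growth rate \<open>Re s / 2\<close> is half the decay rate, so the
        exponential is at most 1; the factor \<open>1 / T\<close> alone tends to 0.\<close>
      also have "\<dots> \<le> CARD('n) * M * 1 / T"
        using s T M0 by (intro divide_right_mono mult_left_mono) auto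
      finally have "cmod (g T) \<le> CARD('n) * M / T"
        by (simp add: g_def norm_mult norm_exp_eq_Re)
      with 1 show ?thesis using norm_triangle_ineq4[of "g T" "g T - g 0"] by simp
    qed
    have "cmod (g 0) \<le> m / Re s + 0"
    proof (rule tendsto_lowerbound)
      show "((\<lambda>T. m / Re s + CARD('n) * M / T) \<longlongrightarrow> m / Re s + 0) at_top"
        by (intro tendsto_add tendsto_const real_tendsto_divide_at_top[OF tendsto_const] filterlim_ident)
      show "\<forall>\<^sub>F T in at_top. cmod (g 0) \<le> m / Re s + CARD('n) * M / T"
        using eventually_gt_at_top[of 0] by eventually_elim (rule estimate)
    qed (rule trivial_limit_at_top_linorder)
    then show "cmod (cdot u (transfer_function A B C s *v v)) \<le> m / Re s"
      by (simp add: cdot_transfer_function g_def impulse_0 u'_def w_def v'_def)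
  qed
  then show ?thesis using s by (simp add: field_simps)
qed

theorem theorem2:
  fixes A :: "real^'n^'n" and B :: "real^'m^'n" and C :: "real^'n^'p"
  assumes "stable A"
  shows "kreiss_norm A B C \<le> transient_peak_norm A B C \<and>
         transient_peak_norm A B C \<le> ereal (exp 1 * real CARD('n)) * kreiss_norm A B C"
proof
  let ?G = "\<lambda>s. Re s * max_singular_value (transfer_function A B C s)"
  let ?E = "\<lambda>t. max_singular_value (complex_matrix (C ** mat_exp (t *\<^sub>R A) ** B))"
  have G: "ereal (?G s) \<le> kreiss_norm A B C" if "Re s > 0" for s
    unfolding kreiss_norm_def using that by (intro SUP_upper) simp
  have E: "ereal (?E t) \<le> transient_peak_norm A B C" if "t \<ge> 0" for t
    unfolding transient_peak_norm_def using that by (intro SUP_upper) simp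
  \<comment> \<open>Nonnegativity excludes \<open>-\<infinity>\<close>, and an infinite norm on the
    right makes the inequality trivial, so only finite values need the estimates.\<close>
  have K0: "0 \<le> kreiss_norm A B C"
    using G[of 1] max_singular_value_nonneg[of "transfer_function A B C 1"] order_trans[of 0 "ereal (?G 1)"]
    by simp
  have M0: "0 \<le> transient_peak_norm A B C"
    using E[of 0] max_singular_value_nonneg[of "complex_matrix (C ** mat_exp (0 *\<^sub>R A) ** B)"]
      order_trans[of 0 "ereal (?E 0)"]
    by simp
  show "kreiss_norm A B C \<le> transient_peak_norm A B C"
  proof (cases "transient_peak_norm A B C")
    case (real m)
    then have "?G s \<le> m" if "Re s > 0" for s
      using E by (intro kreiss_le_peak[OF assms that]) simp
    then show ?thesis unfolding real kreiss_norm_def by (intro SUP_least) simp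
  qed (use M0 in auto)
  show "transient_peak_norm A B C \<le> ereal (exp 1 * real CARD('n)) * kreiss_norm A B C"
  proof (cases "kreiss_norm A B C")
    case (real k)
    then have "?E t \<le> exp 1 * CARD('n) * k" if "t \<ge> 0" for t
      using G by (intro peak_le_kreiss[OF assms that]) simp
    then show ?thesis unfolding real transient_peak_norm_def by (intro SUP_least) simp
  qed (use K0 in auto)
qed

end
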